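(* Let $W$ be a random variable with values in $(0,1)$ and let $L_n$ be the number of empty boxes within the occupancy range in the Bernoulli sieve generated by $W$ with $n$ balls. Suppose that $\mu:=\mathbb{E}|\log W|=\infty$ and that $$\lim_{n\to\infty}\frac{\mathbb{E}W^n}{\mathbb{E}(1-W)^n}=c\in(0,\infty).$$ Then, as $n\to\infty$, $L_n$ converges in distribution to a random variable $L$ having the geometric distribution (starting at zero) with success probability $(c+1)^{-1}$, i.e. $\mathbb{P}\{L=m\}=\frac{1}{c+1}\left(\frac{c}{c+1}\right)^m$, $m\in\mathbb{N}_0$. In particular, if $\mu=\infty$, the same conclusion holds whenever $$\lim_{x\downarrow 0}\frac{\mathbb{P}\{1-W\le x\}}{\mathbb{P}\{W\le x\}}=c\in(0,\infty).$$
   Context: Bernoulli sieve: let $(W_k)_{k\in\mathbb{N}}$ be independent copies of a random variable $W$ with values in $(0,1)$, and put $T_0:=1$, $T_k:=W_1\cdots W_k$. Let $(U_k)_{k\in\mathbb{N}}$ be independent random variables, uniform on $[0,1]$, independent of $(W_k)$. The boxes are the intervals $(T_k,T_{k-1}]$, $k=1,2,\ldots$ (box $k$), and the balls are the points $U_1,\dots,U_n$; thus, given $(W_k)$, a ball falls in box $k$ with probability $P_k=T_{k-1}-T_k=W_1\cdots W_{k-1}(1-W_k)$. With $n$ balls, $K_n$ denotes the number of occupied boxes, $M_n$ the index of the last occupied box (largest $k$ such that box $k$ contains at least one ball), and $L_n:=M_n-K_n$ the number of empty boxes within the occupancy range. *)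

theory Defs
  imports "HOL-Probability.Probability"
begin

text \<open>All sequences are indexed by \<open>{1..}\<close>; the values \<open>Ws 0\<close> and \<open>U 0\<close> are never used. The
  copies \<open>Ws k\<close> are tied to \<open>W\<close> through their law only, so they lie in \<open>(0,1)\<close> almost surely.\<close>

locale bernoulli_sieve = prob_space M for M :: "'a measure" +
  fixes W :: "'a \<Rightarrow> real" and Ws U :: "nat \<Rightarrow> 'a \<Rightarrow> real"
  assumes W_measurable: "random_variable borel W"
    and W_range: "\<And>\<omega>. \<omega> \<in> space M \<Longrightarrow> W \<omega> \<in> {0<..<1}"
    and Ws_indep: "indep_vars (\<lambda>_. borel) Ws {1..}"
    and Ws_copies: "\<And>k. k \<ge> 1 \<Longrightarrow> distr M borel (Ws k) = distr M borel W"
    and U_indep: "indep_vars (\<lambda>_. borel) U {1..}"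
    and U_uniform: "\<And>k. k \<ge> 1 \<Longrightarrow> distr M borel (U k) = uniform_measure lborel {0..1}"
    and Ws_U_indep: "indep_var
          (Pi\<^sub>M {1..} (\<lambda>_. borel)) (\<lambda>\<omega>. \<lambda>k\<in>{1..}. Ws k \<omega>)
          (Pi\<^sub>M {1..} (\<lambda>_. borel)) (\<lambda>\<omega>. \<lambda>k\<in>{1..}. U k \<omega>)"

definition sieve_T :: "(nat \<Rightarrow> 'a \<Rightarrow> real) \<Rightarrow> nat \<Rightarrow> 'a \<Rightarrow> real" where
  "sieve_T Ws k \<omega> = (\<Prod>i=1..k. Ws i \<omega>)"

definition sieve_box :: "(nat \<Rightarrow> 'a \<Rightarrow> real) \<Rightarrow> nat \<Rightarrow> 'a \<Rightarrow> real set" where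
  "sieve_box Ws k \<omega> = {sieve_T Ws k \<omega> <.. sieve_T Ws (k - 1) \<omega>}"

definition occupied_boxes ::
  "(nat \<Rightarrow> 'a \<Rightarrow> real) \<Rightarrow> (nat \<Rightarrow> 'a \<Rightarrow> real) \<Rightarrow> nat \<Rightarrow> 'a \<Rightarrow> nat set" where
  "occupied_boxes Ws U n \<omega> = {k. k \<ge> 1 \<and> (\<exists>i\<in>{1..n}. U i \<omega> \<in> sieve_box Ws k \<omega>)}"

definition num_occupied ::
  "(nat \<Rightarrow> 'a \<Rightarrow> real) \<Rightarrow> (nat \<Rightarrow> 'a \<Rightarrow> real) \<Rightarrow> nat \<Rightarrow> 'a \<Rightarrow> nat" where
  "num_occupied Ws U n \<omega> = card (occupied_boxes Ws U n \<omega>)"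

text \<open>The case without any occupied box has probability zero for \<open>n \<ge> 1\<close>.\<close>

definition last_occupied ::
  "(nat \<Rightarrow> 'a \<Rightarrow> real) \<Rightarrow> (nat \<Rightarrow> 'a \<Rightarrow> real) \<Rightarrow> nat \<Rightarrow> 'a \<Rightarrow> nat" where
  "last_occupied Ws U n \<omega> =
     (if occupied_boxes Ws U n \<omega> = {} then 0 else Max (occupied_boxes Ws U n \<omega>))"

text \<open>The subtraction is not truncated when the set of occupied boxes is finite, which holds
  almost surely, as then it is a subset of \<open>{1..last_occupied Ws U n \<omega>}\<close>.\<close>

definition num_empty ::
  "(nat \<Rightarrow> 'a \<Rightarrow> real) \<Rightarrow> (nat \<Rightarrow> 'a \<Rightarrow> real) \<Rightarrow> nat \<Rightarrow> 'a \<Rightarrow> nat" where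
  "num_empty Ws U n \<omega> = last_occupied Ws U n \<omega> - num_occupied Ws U n \<omega>"

end

theory Submission
  imports Defs
begin

text \<open>
  Reveal the boxes one by one. The set of balls beyond the first \<open>K\<close> boxes is a Markov chain: from \<open>m\<close>
  remaining balls, the next box is empty with probability \<open>a m = E W^m\<close> and takes all of them with probability
  \<open>b m = E (1 - W)^m\<close>. For \<open>g = 1 / (c + 1 - c s)\<close>, the quantity \<open>s^(number of empty boxes so far)\<close> times
  (\<open>g\<close>, or \<open>1\<close> once no ball remains) changes in one step by \<open>g (1 - s) (c b m - a m)\<close> on average, so it would
  be a martingale if \<open>a m = c b m\<close> held exactly, and then \<open>E s^L = g\<close>, which is the geometric transform. In
  general \<open>a m - c b m = o(b m)\<close>. The sum of the \<open>b m\<close> along the chain has expectation at most 1, being the probability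
  of absorption, so it remains to see that the expected number of visits to each fixed \<open>m \<ge> 1\<close> vanishes as
  \<open>n \<longrightarrow> \<infinity>\<close>. Up to a constant, it is at most \<open>z n\<close>, where \<open>z x\<close> is the sum over \<open>K\<close> of
  \<open>E (min (x T_K) (1 / (x T_K)))\<close>.

  That \<open>z\<close> tends to 0 is the renewal theorem for infinite mean. The function \<open>z\<close> solves \<open>z x = bump x + E (z (x W))\<close>,
  so near a positive upper limit \<open>h\<close> of \<open>z\<close> one finds a further near-maximal point \<open>x w\<close> with \<open>w\<close> in a fixed
  compact subinterval of \<open>(0,1)\<close>, and hence arbitrarily long chains of such points. The companion potential \<open>A\<close> of
  \<open>ramp\<close> grows along such a chain at a fixed rate in \<open>ln x\<close>, whereas \<open>E (A x - A (x W)) = ramp x \<le> 2\<close>; this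
  forces \<open>E |ln W| < \<infinity>\<close>.

  The condition on the tails implies the one on the moments by comparing \<open>E (1 - X)^n\<close> for \<open>X = 1 - W\<close> and
  \<open>X = W\<close> through the layer cake formula. Only the lower tails of \<open>X\<close> near 0 matter, as the rest is
  exponentially small.
\<close>

section \<open>Moments and lower tails\<close>

context prob_space begin

text \<open>Layer cake formula: \<open>ennreal (f \<omega>)\<close> is the length of
  \<open>{0<..f \<omega>}\<close>, and Tonelli exchanges the two integrals.\<close>

lemma nn_integral_eq_tail_integral:
  fixes f :: "'a \<Rightarrow> real"
  assumes [measurable]: "random_variable borel f"
  shows "(\<integral>\<^sup>+\<omega>. ennreal (f \<omega>) \<partial>M)
    = (\<integral>\<^sup>+t. ennreal (prob {\<omega> \<in> space M. t \<le> f \<omega>}) * indicator {0<..} t \<partial>lborel)"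
proof -
  interpret pair_sigma_finite M lborel
    by standard
  have "ennreal (f \<omega>) = (\<integral>\<^sup>+t. indicator {0<..} t * indicator {t. t \<le> f \<omega>} t \<partial>lborel)" for \<omega>
  proof -
    have "(\<integral>\<^sup>+t. indicator {0<..} t * indicator {t. t \<le> f \<omega>} t \<partial>lborel)
        = (\<integral>\<^sup>+t. indicator {0<..f \<omega>} t \<partial>lborel)"
      by (intro nn_integral_cong) (auto simp: indicator_def)
    also have "\<dots> = ennreal (f \<omega>)"
      by (cases "0 \<le> f \<omega>") (auto simp: ennreal_neg)
    finally show ?thesis ..
  qed
  then have "(\<integral>\<^sup>+\<omega>. ennreal (f \<omega>) \<partial>M)
      = (\<integral>\<^sup>+\<omega>. (\<integral>\<^sup>+t. indicator {0<..} t * indicator {t. t \<le> f \<omega>} t \<partial>lborel) \<partial>M)"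
    by (intro nn_integral_cong)
  also have "\<dots> = (\<integral>\<^sup>+t. (\<integral>\<^sup>+\<omega>. indicator {0<..} t * indicator {t. t \<le> f \<omega>} t \<partial>M) \<partial>lborel)"
    by (intro Fubini'[symmetric]) measurable
  also have "\<dots> = (\<integral>\<^sup>+t. ennreal (prob {\<omega> \<in> space M. t \<le> f \<omega>}) * indicator {0<..} t \<partial>lborel)"
  proof (intro nn_integral_cong)
    fix t
    have "(\<integral>\<^sup>+\<omega>. indicator {0<..} t * indicator {t. t \<le> f \<omega>} t \<partial>M)
        = (\<integral>\<^sup>+\<omega>. indicator {0<..} t * indicator {\<omega> \<in> space M. t \<le> f \<omega>} \<omega> \<partial>M)"
      by (intro nn_integral_cong) (auto simp: indicator_def)
    also have "\<dots> = ennreal (prob {\<omega> \<in> space M. t \<le> f \<omega>}) * indicator {0<..} t"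
      by (subst nn_integral_cmult) (auto simp: emeasure_eq_measure mult.commute)
    finally show "(\<integral>\<^sup>+\<omega>. indicator {0<..} t * indicator {t. t \<le> f \<omega>} t \<partial>M)
        = ennreal (prob {\<omega> \<in> space M. t \<le> f \<omega>}) * indicator {0<..} t" .
  qed
  finally show ?thesis .
qed

lemma expectation_le_of_tails:
  fixes f g :: "'a \<Rightarrow> real"
  assumes f: "integrable M f" "\<And>\<omega>. \<omega> \<in> space M \<Longrightarrow> 0 \<le> f \<omega>"
    and g: "integrable M g" "\<And>\<omega>. \<omega> \<in> space M \<Longrightarrow> 0 \<le> g \<omega>"
    and "0 \<le> k"
    and tails: "\<And>t. 0 < t \<Longrightarrow> prob {\<omega> \<in> space M. t \<le> f \<omega>} \<le> k * prob {\<omega> \<in> space M. t \<le> g \<omega>}"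
  shows "expectation f \<le> k * expectation g"
proof -
  have [measurable]: "random_variable borel f" "random_variable borel g"
    using f g by auto
  have "ennreal (expectation f) = (\<integral>\<^sup>+\<omega>. ennreal (f \<omega>) \<partial>M)"
    using f by (intro nn_integral_eq_integral[symmetric]) auto
  also have "\<dots> = (\<integral>\<^sup>+t. ennreal (prob {\<omega> \<in> space M. t \<le> f \<omega>}) * indicator {0<..} t \<partial>lborel)"
    by (rule nn_integral_eq_tail_integral) measurable
  also have "\<dots> \<le> (\<integral>\<^sup>+t. ennreal k * (ennreal (prob {\<omega> \<in> space M. t \<le> g \<omega>}) * indicator {0<..} t) \<partial>lborel)"
    using tails \<open>0 \<le> k\<close>
    by (intro nn_integral_mono) (auto simp: indicator_def ennreal_mult[symmetric] intro!: ennreal_leI)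
  also have "\<dots> = ennreal k * (\<integral>\<^sup>+t. ennreal (prob {\<omega> \<in> space M. t \<le> g \<omega>}) * indicator {0<..} t \<partial>lborel)"
    by (intro nn_integral_cmult) measurable
  also have "(\<integral>\<^sup>+t. ennreal (prob {\<omega> \<in> space M. t \<le> g \<omega>}) * indicator {0<..} t \<partial>lborel)
      = (\<integral>\<^sup>+\<omega>. ennreal (g \<omega>) \<partial>M)"
    by (rule nn_integral_eq_tail_integral[symmetric]) measurable
  also have "\<dots> = ennreal (expectation g)"
    using g by (intro nn_integral_eq_integral) auto
  finally have "ennreal (expectation f) \<le> ennreal (k * expectation g)"
    using \<open>0 \<le> k\<close> g by (simp add: ennreal_mult integral_nonneg)
  then show ?thesis
    using \<open>0 \<le> k\<close> g by (subst (asm) ennreal_le_iff) (auto intro: integral_nonneg)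
qed

lemma integrable_moment:
  fixes Z :: "'a \<Rightarrow> real"
  assumes [measurable]: "random_variable borel Z"
    and Z: "\<And>\<omega>. \<omega> \<in> space M \<Longrightarrow> Z \<omega> \<in> {0<..<1}"
  shows "integrable M (\<lambda>\<omega>. (1 - Z \<omega>) ^ n)"
proof (intro integrable_const_bound[of _ 1] AE_I2)
  fix \<omega> assume "\<omega> \<in> space M"
  then have "0 \<le> 1 - Z \<omega>" "1 - Z \<omega> \<le> 1" using Z by force+
  then show "norm ((1 - Z \<omega>) ^ n) \<le> 1" by (simp add: power_le_one)
qed measurable

text \<open>The tails are compared only below \<open>d\<close>, so the power is replaced by
  \<open>g\<close>, the positive part of \<open>(1 - x) ^ n - (1 - d) ^ n\<close>. At positive
  heights the superlevel sets of \<open>g\<close> are lower tails at points below \<open>d\<close>,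
  so the layer cake comparison applies; the truncation costs at most
  \<open>(1 - d) ^ n\<close>.\<close>

lemma moment_le_of_lower_tails:
  fixes X Y :: "'a \<Rightarrow> real"
  assumes [measurable]: "random_variable borel X" "random_variable borel Y"
    and X: "\<And>\<omega>. \<omega> \<in> space M \<Longrightarrow> X \<omega> \<in> {0<..<1}"
    and Y: "\<And>\<omega>. \<omega> \<in> space M \<Longrightarrow> Y \<omega> \<in> {0<..<1}"
    and "0 \<le> k" "0 < d" "d < 1" "0 < n"
    and tails: "\<And>x. 0 < x \<Longrightarrow> x < d \<Longrightarrow>
      prob {\<omega> \<in> space M. X \<omega> \<le> x} \<le> k * prob {\<omega> \<in> space M. Y \<omega> \<le> x}"
  shows "expectation (\<lambda>\<omega>. (1 - X \<omega>) ^ n) \<le> k * expectation (\<lambda>\<omega>. (1 - Y \<omega>) ^ n) + (1 - d) ^ n"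
proof -
  define g where "g x = max 0 ((1 - x) ^ n - (1 - d) ^ n)" for x :: real
  have [measurable]: "g \<in> borel_measurable borel" unfolding g_def by measurable
  have pw: "0 \<le> (1 - z) ^ n" "(1 - z) ^ n \<le> 1" if "z \<in> {0<..<1}" for z :: real
    using that by (auto intro: power_le_one)
  have g: "0 \<le> g z" "g z \<le> (1 - z) ^ n" "(1 - z) ^ n \<le> g z + (1 - d) ^ n" if "z \<in> {0<..<1}" for z
    using pw[OF that] pw[of d] \<open>0 < d\<close> \<open>d < 1\<close> by (auto simp: g_def)
  have int: "integrable M (\<lambda>\<omega>. (1 - Z \<omega>) ^ n)" "integrable M (\<lambda>\<omega>. g (Z \<omega>))"
    if [measurable]: "random_variable borel Z" and "\<And>\<omega>. \<omega> \<in> space M \<Longrightarrow> Z \<omega> \<in> {0<..<1}" for Z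
    using pw[OF that(2)] g[OF that(2)]
    by (intro integrable_const_bound[of _ 1] AE_I2; force)+
  have sub: "{\<omega> \<in> space M. t \<le> g (Z \<omega>)} = {\<omega> \<in> space M. Z \<omega> \<le> 1 - root n (t + (1 - d) ^ n)}"
    if "0 < t" and Z: "\<And>\<omega>. \<omega> \<in> space M \<Longrightarrow> Z \<omega> \<in> {0<..<1}" for t Z
  proof -
    let ?r = "root n (t + (1 - d) ^ n)"
    have r: "?r ^ n = t + (1 - d) ^ n" "0 \<le> ?r"
      using \<open>0 < n\<close> \<open>d < 1\<close> \<open>0 < t\<close> by (auto intro!: real_root_pow_pos2)
    have "t \<le> g z \<longleftrightarrow> z \<le> 1 - ?r" if "z \<in> {0<..<1}" for z
    proof -
      have "t \<le> g z \<longleftrightarrow> ?r ^ n \<le> (1 - z) ^ n"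
        using \<open>0 < t\<close> unfolding g_def r by auto
      also have "\<dots> \<longleftrightarrow> ?r \<le> 1 - z"
        using that r \<open>0 < n\<close> by (intro power_mono_iff) auto
      finally show ?thesis by auto
    qed
    then show ?thesis using Z by auto
  qed
  have "expectation (\<lambda>\<omega>. g (X \<omega>)) \<le> k * expectation (\<lambda>\<omega>. g (Y \<omega>))"
  proof (rule expectation_le_of_tails)
    fix t :: real assume "0 < t"
    let ?x = "1 - root n (t + (1 - d) ^ n)"
    have "root n ((1 - d) ^ n) < root n (t + (1 - d) ^ n)"
      using \<open>0 < n\<close> \<open>0 < t\<close> by (intro real_root_less_mono) auto
    then have "?x < d" using \<open>0 < n\<close> \<open>d < 1\<close> by (simp add: real_root_power_cancel)
    have "prob {\<omega> \<in> space M. X \<omega> \<le> ?x} \<le> k * prob {\<omega> \<in> space M. Y \<omega> \<le> ?x}"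
    proof (cases "0 < ?x")
      case True
      then show ?thesis using tails \<open>?x < d\<close> by blast
    next
      \<comment> \<open>A level at or below 0 gives an empty event, since \<open>X\<close> is
        positive.\<close>
      case False
      then have "{\<omega> \<in> space M. X \<omega> \<le> ?x} = {}" using X by fastforce
      then have "prob {\<omega> \<in> space M. X \<omega> \<le> ?x} = 0" by (simp only: measure_empty)
      then show ?thesis using \<open>0 \<le> k\<close> by simp
    qed
    then show "prob {\<omega> \<in> space M. t \<le> g (X \<omega>)} \<le> k * prob {\<omega> \<in> space M. t \<le> g (Y \<omega>)}"
      by (simp only: sub[OF \<open>0 < t\<close> X] sub[OF \<open>0 < t\<close> Y])
  qed (use X Y \<open>0 \<le> k\<close> g int in auto)
  also have "\<dots> \<le> k * expectation (\<lambda>\<omega>. (1 - Y \<omega>) ^ n)"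
    using g[OF Y] Y \<open>0 \<le> k\<close> by (intro mult_left_mono integral_mono int) auto
  finally have "expectation (\<lambda>\<omega>. g (X \<omega>)) \<le> k * expectation (\<lambda>\<omega>. (1 - Y \<omega>) ^ n)" .
  moreover have "expectation (\<lambda>\<omega>. (1 - X \<omega>) ^ n) \<le> expectation (\<lambda>\<omega>. g (X \<omega>) + (1 - d) ^ n)"
    using g[OF X] X by (intro integral_mono Bochner_Integration.integrable_add integrable_const int) auto
  moreover have "expectation (\<lambda>\<omega>. g (X \<omega>) + (1 - d) ^ n) = expectation (\<lambda>\<omega>. g (X \<omega>)) + (1 - d) ^ n"
    using int(2)[OF assms(1) X] by (simp add: prob_space)
  ultimately show ?thesis by linarith
qed

lemma moment_ge_lower_tail:
  fixes Y :: "'a \<Rightarrow> real"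
  assumes [measurable]: "random_variable borel Y"
    and Y: "\<And>\<omega>. \<omega> \<in> space M \<Longrightarrow> Y \<omega> \<in> {0<..<1}" and "x \<le> 1"
  shows "prob {\<omega> \<in> space M. Y \<omega> \<le> x} * (1 - x) ^ n \<le> expectation (\<lambda>\<omega>. (1 - Y \<omega>) ^ n)"
proof -
  have "prob {\<omega> \<in> space M. Y \<omega> \<le> x} * (1 - x) ^ n
      = expectation (\<lambda>\<omega>. (1 - x) ^ n * indicator {\<omega> \<in> space M. Y \<omega> \<le> x} \<omega>)"
    by (simp add: mult.commute)
  also have "\<dots> \<le> expectation (\<lambda>\<omega>. (1 - Y \<omega>) ^ n)"
  proof (rule integral_mono)
    show "integrable M (\<lambda>\<omega>. (1 - Y \<omega>) ^ n)"
      using assms(1) Y by (rule integrable_moment)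
    fix \<omega> assume "\<omega> \<in> space M"
    then show "(1 - x) ^ n * indicator {\<omega> \<in> space M. Y \<omega> \<le> x} \<omega> \<le> (1 - Y \<omega>) ^ n"
      using Y[of \<omega>] \<open>x \<le> 1\<close> by (auto simp: indicator_def intro!: power_mono)
  qed (auto simp: emeasure_eq_measure)
  finally show ?thesis .
qed

text \<open>The truncation error is absorbed by the gap between \<open>k\<close> and
  \<open>u\<close>: the moment of \<open>Y\<close> is at least \<open>p * (1 - d / 2) ^ n\<close>
  with \<open>p > 0\<close>, which for large \<open>n\<close> exceeds any fixed multiple of
  \<open>(1 - d) ^ n\<close>.\<close>

lemma eventually_moment_less:
  fixes X Y :: "'a \<Rightarrow> real"
  assumes [measurable]: "random_variable borel X" "random_variable borel Y"
    and X: "\<And>\<omega>. \<omega> \<in> space M \<Longrightarrow> X \<omega> \<in> {0<..<1}"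
    and Y: "\<And>\<omega>. \<omega> \<in> space M \<Longrightarrow> Y \<omega> \<in> {0<..<1}"
    and "0 \<le> k" "k < u"
    and pos: "\<And>x. 0 < x \<Longrightarrow> 0 < prob {\<omega> \<in> space M. Y \<omega> \<le> x}"
    and tails: "eventually (\<lambda>x. prob {\<omega> \<in> space M. X \<omega> \<le> x} \<le> k * prob {\<omega> \<in> space M. Y \<omega> \<le> x}) (at_right 0)"
  shows "eventually (\<lambda>n. expectation (\<lambda>\<omega>. (1 - X \<omega>) ^ n) < u * expectation (\<lambda>\<omega>. (1 - Y \<omega>) ^ n)) sequentially"
proof -
  obtain d0 where "0 < d0" and d0: "\<And>x. 0 < x \<Longrightarrow> x < d0 \<Longrightarrow>
      prob {\<omega> \<in> space M. X \<omega> \<le> x} \<le> k * prob {\<omega> \<in> space M. Y \<omega> \<le> x}"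
    using tails by (auto simp: eventually_at_right_field)
  define d where "d = min d0 (1 / 2)"
  have d: "0 < d" "d < 1" "d \<le> d0" using \<open>0 < d0\<close> by (auto simp: d_def)
  define p where "p = prob {\<omega> \<in> space M. Y \<omega> \<le> d / 2}"
  have "0 < p" unfolding p_def using pos[of "d / 2"] d by simp
  have "(\<lambda>n. ((1 - d) / (1 - d / 2)) ^ n) \<longlonglongrightarrow> 0"
    using d by (intro LIMSEQ_realpow_zero) (auto simp: field_simps)
  moreover have "0 < (u - k) * p" using \<open>0 < p\<close> \<open>k < u\<close> by simp
  ultimately have "eventually (\<lambda>n. ((1 - d) / (1 - d / 2)) ^ n < (u - k) * p) sequentially"
    by (rule order_tendstoD)
  then show ?thesis
    using eventually_gt_at_top[of 0]
  proof eventually_elim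
    case (elim n)
    let ?b = "expectation (\<lambda>\<omega>. (1 - Y \<omega>) ^ n)"
    have "0 < (1 - d / 2) ^ n" using d by simp
    then have "(1 - d) ^ n < (u - k) * (p * (1 - d / 2) ^ n)"
      using elim(1) unfolding power_divide by (simp only: pos_divide_less_eq mult.assoc)
    also have "\<dots> \<le> (u - k) * ?b"
      using moment_ge_lower_tail[OF assms(2) Y, of "d / 2" n] d \<open>k < u\<close>
      by (intro mult_left_mono) (auto simp: p_def)
    finally have "(1 - d) ^ n < (u - k) * ?b" .
    moreover have "expectation (\<lambda>\<omega>. (1 - X \<omega>) ^ n) \<le> k * ?b + (1 - d) ^ n"
      using elim d d0 by (intro moment_le_of_lower_tails X Y \<open>0 \<le> k\<close>) auto
    ultimately show ?case by (simp add: algebra_simps)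
  qed
qed

text \<open>One comparison gives the upper bound; the same comparison with \<open>X\<close> and
  \<open>Y\<close> exchanged and the constants inverted gives the lower bound.\<close>

lemma moment_ratio_tendsto:
  fixes X Y :: "'a \<Rightarrow> real"
  assumes rv: "random_variable borel X" "random_variable borel Y"
    and X: "\<And>\<omega>. \<omega> \<in> space M \<Longrightarrow> X \<omega> \<in> {0<..<1}"
    and Y: "\<And>\<omega>. \<omega> \<in> space M \<Longrightarrow> Y \<omega> \<in> {0<..<1}"
    and "0 < c"
    and lim: "((\<lambda>x. prob {\<omega> \<in> space M. X \<omega> \<le> x} / prob {\<omega> \<in> space M. Y \<omega> \<le> x}) \<longlongrightarrow> c) (at_right 0)"
  shows "(\<lambda>n. expectation (\<lambda>\<omega>. (1 - X \<omega>) ^ n) / expectation (\<lambda>\<omega>. (1 - Y \<omega>) ^ n)) \<longlonglongrightarrow> c"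
proof -
  note [measurable] = rv
  let ?F = "\<lambda>Z x. prob {\<omega> \<in> space M. Z \<omega> \<le> x}"
  let ?m = "\<lambda>Z n. expectation (\<lambda>\<omega>. (1 - Z \<omega>) ^ n)"
  have "eventually (\<lambda>x. 0 < ?F X x / ?F Y x) (at_right 0)"
    using order_tendstoD(1)[OF lim \<open>0 < c\<close>] .
  then obtain d where "0 < d" and d: "\<And>x. 0 < x \<Longrightarrow> x < d \<Longrightarrow> 0 < ?F X x / ?F Y x"
    by (auto simp: eventually_at_right_field)
  \<comment> \<open>Division by 0 yields 0, so a positive quotient makes both probabilities positive
    near 0; monotonicity carries this to every \<open>x > 0\<close>.\<close>
  have pos: "0 < ?F X x" "0 < ?F Y x" if "0 < x" for x
  proof -
    let ?y = "min x (d / 2)"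
    have "0 < ?F X ?y" "0 < ?F Y ?y"
      using d[of ?y] that \<open>0 < d\<close> by (auto simp: zero_less_divide_iff not_less[symmetric] measure_nonneg dest: leD)
    moreover have "?F X ?y \<le> ?F X x" "?F Y ?y \<le> ?F Y x"
      by (auto intro!: finite_measure_mono)
    ultimately show "0 < ?F X x" "0 < ?F Y x" by linarith+
  qed
  have mpos: "0 < ?m Y n" for n
  proof (intro expectation_greater AE_I2)
    show "integrable M (\<lambda>\<omega>. (1 - Y \<omega>) ^ n)"
      using rv(2) Y by (rule integrable_moment)
  qed (use Y in auto)
  show ?thesis
  proof (rule order_tendstoI)
    fix u assume "c < u"
    then obtain k where k: "c < k" "k < u" using dense by blast
    have "eventually (\<lambda>x. ?F X x / ?F Y x < k) (at_right 0)"
      using order_tendstoD(2)[OF lim] k by blast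
    then have "eventually (\<lambda>x. ?F X x \<le> k * ?F Y x) (at_right 0)"
      using eventually_at_right_less[of 0]
      by eventually_elim (use pos in \<open>auto simp: field_simps\<close>)
    then have "eventually (\<lambda>n. ?m X n < u * ?m Y n) sequentially"
      using k \<open>0 < c\<close> by (intro eventually_moment_less[OF rv X Y _ _ pos(2)]) auto
    then show "eventually (\<lambda>n. ?m X n / ?m Y n < u) sequentially"
      using mpos by (auto elim!: eventually_mono simp: field_simps)
  next
    fix l assume "l < c"
    show "eventually (\<lambda>n. l < ?m X n / ?m Y n) sequentially"
    proof (cases "l \<le> 0")
      case True
      have "0 < ?m X n" for n
      proof (intro expectation_greater AE_I2)
        show "integrable M (\<lambda>\<omega>. (1 - X \<omega>) ^ n)"
          using rv(1) X by (rule integrable_moment)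
      qed (use X in auto)
      then show ?thesis using True mpos by (auto intro!: always_eventually le_less_trans[of l 0])
    next
      case False
      then obtain k where k: "l < k" "k < c" using dense \<open>l < c\<close> by blast
      have "eventually (\<lambda>x. k < ?F X x / ?F Y x) (at_right 0)"
        using order_tendstoD(1)[OF lim] k by blast
      then have "eventually (\<lambda>x. ?F Y x \<le> 1 / k * ?F X x) (at_right 0)"
        using eventually_at_right_less[of 0]
        by eventually_elim (use pos k False in \<open>auto simp: field_simps\<close>)
      then have "eventually (\<lambda>n. ?m Y n < 1 / l * ?m X n) sequentially"
        using k False by (intro eventually_moment_less[OF rv(2,1) Y X, of "1 / k"] pos(1)) (auto simp: field_simps)
      then show ?thesis
        using mpos False by (auto elim!: eventually_mono simp: field_simps)
    qed
  qed
qed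

end

section \<open>A renewal theorem for infinite mean\<close>

text \<open>The renewal theory concerns the law of a single factor, so it is set up apart from the
  sieve, which inherits it as a sublocale.\<close>

locale unit_factor = prob_space M for M :: "'a measure" +
  fixes W :: "'a \<Rightarrow> real"
  assumes factor_measurable [measurable]: "random_variable borel W"
    and factor_range: "\<And>\<omega>. \<omega> \<in> space M \<Longrightarrow> W \<omega> \<in> {0<..<1}"
begin

lemma factor_pos: "\<omega> \<in> space M \<Longrightarrow> 0 < W \<omega>"
  and factor_less_1: "\<omega> \<in> space M \<Longrightarrow> W \<omega> < 1"
  using factor_range by auto

lemma integrable_bounded:
  fixes f :: "'a \<Rightarrow> real"
  assumes "f \<in> borel_measurable M" "\<And>\<omega>. \<omega> \<in> space M \<Longrightarrow> 0 \<le> f \<omega> \<and> f \<omega> \<le> B"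
  shows "integrable M f"
  using assms by (intro integrable_const_bound[of _ B]) auto

lemma integrable_factor [simp]: "integrable M W"
  using factor_range by (intro integrable_bounded[of _ 1]) (auto intro: less_imp_le)

lemma expectation_factor_less_1: "expectation W < 1"
  by (intro expectation_less integrable_factor) (auto simp: factor_less_1)

lemma expectation_factor_pos: "0 < expectation W"
  by (intro expectation_greater integrable_factor) (auto simp: factor_pos)

section \<open>Transition operator and potential of the multiplicative walk\<close>

text \<open>One step of the walk multiplies the position by an independent copy of \<open>W\<close>;
  the power \<open>step ^^ k\<close> averages \<open>f\<close> over the position after
  \<open>k\<close> steps from \<open>x\<close>.\<close>

definition step :: "(real \<Rightarrow> real) \<Rightarrow> real \<Rightarrow> real" where
  "step f x = expectation (\<lambda>\<omega>. f (x * W \<omega>))"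

lemma step_pow_Suc: "(step ^^ Suc k) f x = expectation (\<lambda>\<omega>. (step ^^ k) f (x * W \<omega>))"
  by (simp add: step_def)

lemma step_measurable [measurable]:
  assumes [measurable]: "f \<in> borel_measurable borel"
  shows "step f \<in> borel_measurable borel"
  unfolding step_def by measurable

lemma step_pow_measurable [measurable]:
  "f \<in> borel_measurable borel \<Longrightarrow> (step ^^ k) f \<in> borel_measurable borel"
  by (induction k) auto

lemma step_pow_bounds:
  assumes [measurable]: "f \<in> borel_measurable borel"
    and "\<And>x. 0 \<le> f x" "\<And>x. f x \<le> B"
  shows "0 \<le> (step ^^ k) f x \<and> (step ^^ k) f x \<le> B"
proof (induction k arbitrary: x)
  case (Suc k)
  have "integrable M (\<lambda>\<omega>. (step ^^ k) f (x * W \<omega>))"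
    using Suc by (intro integrable_bounded[of _ B]) auto
  then show ?case
    unfolding step_pow_Suc
    by (intro conjI integral_nonneg integral_le_const AE_I2) (simp_all add: Suc.IH)
qed (use assms in auto)

lemma step_pow_integrable:
  assumes [measurable]: "f \<in> borel_measurable borel"
    and "\<And>x. 0 \<le> f x" "\<And>x. f x \<le> B"
  shows "integrable M (\<lambda>\<omega>. (step ^^ k) f (x * W \<omega>))"
  using step_pow_bounds[OF assms, of k] by (intro integrable_bounded[of _ B]) auto

text \<open>The identity is an eigenfunction of \<open>step\<close> with eigenvalue
  \<open>expectation W < 1\<close>, so a bound by it decays geometrically under iteration.\<close>

lemma step_pow_le_geometric:
  assumes [measurable]: "f \<in> borel_measurable borel"
    and "\<And>x. 0 \<le> f x" "\<And>x. f x \<le> B" "\<And>x. f x \<le> \<bar>x\<bar>"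
  shows "0 \<le> x \<Longrightarrow> (step ^^ k) f x \<le> x * expectation W ^ k"
proof (induction k arbitrary: x)
  case 0
  then show ?case using assms(4)[of x] by simp
next
  case (Suc k)
  have "(step ^^ Suc k) f x = expectation (\<lambda>\<omega>. (step ^^ k) f (x * W \<omega>))"
    by (rule step_pow_Suc)
  also have "\<dots> \<le> expectation (\<lambda>\<omega>. x * W \<omega> * expectation W ^ k)"
  proof (intro integral_mono step_pow_integrable[OF assms(1-3)])
    fix \<omega> assume "\<omega> \<in> space M"
    then show "(step ^^ k) f (x * W \<omega>) \<le> x * W \<omega> * expectation W ^ k"
      using Suc factor_pos[of \<omega>] by simp
  qed auto
  finally show ?case by (simp add: mult_ac)
qed

text \<open>The Green potential of \<open>f\<close>: the total expected value of \<open>f\<close>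
  along the path of the walk.\<close>

definition potential :: "(real \<Rightarrow> real) \<Rightarrow> real \<Rightarrow> real" where
  "potential f x = (\<Sum>k. (step ^^ k) f x)"

lemma potential_measurable [measurable]:
  assumes [measurable]: "f \<in> borel_measurable borel"
  shows "potential f \<in> borel_measurable borel"
  unfolding potential_def by measurable

text \<open>The majorant \<open>x * expectation W ^ k\<close> gives all convergence, and it bounds
  the potential at \<open>x * W \<omega>\<close> by a constant because
  \<open>x * W \<omega> \<le> x\<close>. The renewal equation splits off the term
  \<open>k = 0\<close> and exchanges sum and expectation in the rest.\<close>

lemma potential_facts:
  assumes [measurable]: "f \<in> borel_measurable borel"
    and bounds: "\<And>x. 0 \<le> f x" "\<And>x. f x \<le> B" and lin: "\<And>x. f x \<le> \<bar>x\<bar>"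
    and "0 \<le> x"
  shows potential_summable: "summable (\<lambda>k. (step ^^ k) f x)"
    and potential_nonneg: "0 \<le> potential f x"
    and potential_le_linear: "potential f x \<le> x / (1 - expectation W)"
    and potential_integrable: "integrable M (\<lambda>\<omega>. potential f (x * W \<omega>))"
    and potential_renewal: "potential f x = f x + expectation (\<lambda>\<omega>. potential f (x * W \<omega>))"
proof -
  let ?m = "expectation W"
  note m = expectation_factor_less_1 expectation_factor_pos
  have geo: "(\<lambda>k. y * ?m ^ k) sums (y / (1 - ?m))" for y
    using sums_mult[OF geometric_sums[of ?m], of y] m by simp
  have le: "norm ((step ^^ k) f y) \<le> y * ?m ^ k" if "0 \<le> y" for k y
    using step_pow_le_geometric[OF assms(1-4) that, of k] step_pow_bounds[OF assms(1-3), of k y]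
    by simp
  have sm: "summable (\<lambda>k. (step ^^ k) f x)" if "0 \<le> x" for x
    using le[OF that] by (intro summable_comparison_test'[OF sums_summable[OF geo[of x]]]) auto
  have nn: "0 \<le> potential f x" if "0 \<le> x" for x
    unfolding potential_def using step_pow_bounds[OF assms(1-3)] sm[OF that]
    by (intro suminf_nonneg) auto
  have ub: "potential f x \<le> x / (1 - ?m)" if "0 \<le> x" for x
    unfolding potential_def sums_unique[OF geo[of x]] using le[OF that] sm[OF that]
    by (intro suminf_le sums_summable[OF geo[of x]]) (auto simp: abs_le_iff)
  show "summable (\<lambda>k. (step ^^ k) f x)" "0 \<le> potential f x" "potential f x \<le> x / (1 - ?m)"
    using sm nn ub \<open>0 \<le> x\<close> by auto
  note int = step_pow_integrable[OF assms(1-3)]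
  have "0 \<le> potential f (x * W \<omega>) \<and> potential f (x * W \<omega>) \<le> x / (1 - ?m)" if "\<omega> \<in> space M" for \<omega>
  proof -
    have "0 \<le> x * W \<omega>" "x * W \<omega> \<le> x"
      using factor_range[OF that] \<open>0 \<le> x\<close> by (auto simp: mult_left_le)
    then show ?thesis
      using nn[of "x * W \<omega>"] ub[of "x * W \<omega>"] m divide_right_mono[of "x * W \<omega>" x "1 - ?m"] by simp
  qed
  then show "integrable M (\<lambda>\<omega>. potential f (x * W \<omega>))"
    by (intro integrable_bounded[of _ "x / (1 - ?m)"]) auto
  have "expectation (\<lambda>\<omega>. potential f (x * W \<omega>)) = (\<Sum>k. expectation (\<lambda>\<omega>. (step ^^ k) f (x * W \<omega>)))"
    unfolding potential_def
  proof (rule integral_suminf[OF int])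
    show "AE \<omega> in M. summable (\<lambda>k. norm ((step ^^ k) f (x * W \<omega>)))"
    proof (rule AE_I2)
      fix \<omega> assume "\<omega> \<in> space M"
      then have "0 \<le> x * W \<omega>" using factor_pos[of \<omega>] \<open>0 \<le> x\<close> by simp
      then show "summable (\<lambda>k. norm ((step ^^ k) f (x * W \<omega>)))"
        using sm[of "x * W \<omega>"] step_pow_bounds[OF assms(1-3)] by simp
    qed
    have "(\<lambda>k. expectation (\<lambda>\<omega>. norm ((step ^^ k) f (x * W \<omega>)))) = (\<lambda>k. (step ^^ Suc k) f x)"
      unfolding step_pow_Suc using step_pow_bounds[OF assms(1-3)] by simp
    then show "summable (\<lambda>k. expectation (\<lambda>\<omega>. norm ((step ^^ k) f (x * W \<omega>))))"
      using sm[OF \<open>0 \<le> x\<close>] by (subst (asm) summable_Suc_iff[symmetric]) simp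
  qed
  also have "\<dots> = (\<Sum>k. (step ^^ Suc k) f x)"
    unfolding step_pow_Suc ..
  also have "\<dots> = potential f x - f x"
    unfolding potential_def using suminf_split_head[OF sm[OF \<open>0 \<le> x\<close>]] by simp
  finally show "potential f x = f x + expectation (\<lambda>\<omega>. potential f (x * W \<omega>))"
    by simp
qed

section \<open>Bump, ramp and the uniform bound on the bump potential\<close>

text \<open>Up to a constant depending on \<open>m\<close>, a majorant for the binomial probability
  that exactly \<open>m \<ge> 1\<close> of \<open>n\<close> balls lie below level \<open>t\<close>,
  as a function of \<open>x = n * t\<close>. It decays both towards 0 and towards infinity.\<close>

definition bump :: "real \<Rightarrow> real" where
  "bump x = (if x \<le> 0 then 0 else min x (1 / x))"

text \<open>The primitive of \<open>bump x / x\<close>.\<close>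

definition ramp :: "real \<Rightarrow> real" where
  "ramp x = (if x \<le> 0 then 0 else if x \<le> 1 then x else 2 - 1 / x)"

lemma bump_measurable [measurable]: "bump \<in> borel_measurable borel"
  unfolding bump_def by measurable

lemma ramp_measurable [measurable]: "ramp \<in> borel_measurable borel"
  unfolding ramp_def by measurable

lemma bump_bounds: "0 \<le> bump x" "bump x \<le> 1" "bump x \<le> \<bar>x\<bar>" "bump x \<le> 1 / x \<or> x \<le> 0"
proof -
  show "bump x \<le> 1"
  proof (cases "x \<le> 1")
    case False
    then show ?thesis by (simp add: bump_def min_le_iff_disj)
  qed (simp add: bump_def min_le_iff_disj)
qed (auto simp: bump_def)

lemma ramp_bounds: "0 \<le> ramp x" "ramp x \<le> 2" "ramp x \<le> \<bar>x\<bar>"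
proof -
  have "2 - 1 / x \<le> x" if "x > 0"
  proof -
    have "0 \<le> (x - 1)\<^sup>2 / x" using that by simp
    also have "\<dots> = x - (2 - 1 / x)" using that by (simp add: field_simps power2_eq_square)
    finally show ?thesis by simp
  qed
  then show "ramp x \<le> \<bar>x\<bar>" by (auto simp: ramp_def)
  show "0 \<le> ramp x"
  proof (cases "x \<le> 1")
    case False
    then have "1 / x \<le> 1" by simp
    then have "0 \<le> 2 - 1 / x" by linarith
    then show ?thesis by (simp add: ramp_def)
  qed (simp add: ramp_def)
  show "ramp x \<le> 2"
    by (simp add: ramp_def)
qed

text \<open>The right-hand side is the integral of \<open>bump u / u\<close> over \<open>u\<close>
  from \<open>y\<close> to \<open>x\<close>. As \<open>bump u / u = min 1 (1 / u ^ 2)\<close> is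
  decreasing, its value at \<open>x\<close> times \<open>x - y\<close> is a lower bound. The cases
  are the positions of 1 relative to \<open>y\<close> and \<open>x\<close>.\<close>

lemma ramp_diff_ge:
  assumes "0 < y" "y \<le> x"
  shows "(1 - y / x) * bump x \<le> ramp x - ramp y"
proof -
  consider "x \<le> 1" | "1 < x" "y \<le> 1" | "1 < y" by linarith
  then show ?thesis
  proof cases
    case 1
    then have "x \<le> 1 / x" using assms by (simp add: field_simps mult_le_one)
    then show ?thesis using 1 assms by (simp add: bump_def ramp_def field_simps)
  next
    case 2
    \<comment> \<open>A factorisation of the difference of the two sides in which every factor is
      visibly nonnegative for \<open>y \<le> 1 < x\<close>.\<close>
    have "0 \<le> (x - 1) * ((x - y) + x * (1 - y)) / x\<^sup>2"
      using 2 assms by (intro divide_nonneg_nonneg mult_nonneg_nonneg add_nonneg_nonneg) auto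
    also have "\<dots> = 2 - 1 / x - y - (1 - y / x) * (1 / x)"
      using 2 by (simp add: divide_simps power2_eq_square) (simp add: algebra_simps)
    finally have "(1 - y / x) * (1 / x) \<le> 2 - 1 / x - y" by simp
    moreover have "1 / x \<le> 1" using 2 by simp
    then have "min x (1 / x) = 1 / x" using 2 by linarith
    ultimately show ?thesis using 2 assms by (simp add: bump_def ramp_def)
  next
    case 3
    have "1 / x \<le> 1" using 3 assms by simp
    then have "min x (1 / x) = 1 / x" using 3 assms by linarith
    moreover have "(1 - y / x) * (1 / x) \<le> (1 - y / x) * (1 / y)"
      using 3 assms by (intro mult_left_mono) (auto simp: field_simps)
    moreover have "(1 - y / x) * (1 / y) = 1 / y - 1 / x"
      using 3 assms by (simp add: field_simps)
    ultimately show ?thesis using 3 assms by (simp add: bump_def ramp_def)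
  qed
qed

lemmas bump_pow_integrable = step_pow_integrable[OF bump_measurable bump_bounds(1,2)]
lemmas ramp_pow_integrable = step_pow_integrable[OF ramp_measurable ramp_bounds(1,2)]
lemmas bump_potential = potential_facts[OF bump_measurable bump_bounds(1-3)]
lemmas ramp_potential = potential_facts[OF ramp_measurable ramp_bounds(1-3)]

text \<open>The ratio \<open>y / x\<close> does not change when both points are multiplied by
  \<open>W \<omega>\<close>, so \<open>ramp_diff_ge\<close> survives every application of
  \<open>step\<close>.\<close>

lemma ramp_pow_diff_ge:
  "0 < y \<Longrightarrow> y \<le> x \<Longrightarrow> (1 - y / x) * (step ^^ k) bump x \<le> (step ^^ k) ramp x - (step ^^ k) ramp y"
proof (induction k arbitrary: x y)
  case (Suc k)
  have "(1 - y / x) * expectation (\<lambda>\<omega>. (step ^^ k) bump (x * W \<omega>))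
      = expectation (\<lambda>\<omega>. (1 - y / x) * (step ^^ k) bump (x * W \<omega>))"
    by simp
  also have "\<dots> \<le> expectation (\<lambda>\<omega>. (step ^^ k) ramp (x * W \<omega>) - (step ^^ k) ramp (y * W \<omega>))"
  proof (intro integral_mono integrable_mult_right bump_pow_integrable Bochner_Integration.integrable_diff
      ramp_pow_integrable)
    fix \<omega> assume "\<omega> \<in> space M"
    then have "0 < W \<omega>" by (rule factor_pos)
    then show "(1 - y / x) * (step ^^ k) bump (x * W \<omega>)
        \<le> (step ^^ k) ramp (x * W \<omega>) - (step ^^ k) ramp (y * W \<omega>)"
      using Suc.IH[of "y * W \<omega>" "x * W \<omega>"] Suc.prems by simp
  qed
  finally show ?case
    unfolding step_pow_Suc using ramp_pow_integrable by simp
qed (use ramp_diff_ge in simp)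

text \<open>Summation of \<open>ramp_pow_diff_ge\<close> over \<open>k\<close>. Where the bump
  potential is bounded below, the ramp potential must fall by a definite amount over a fixed ratio;
  this turns a positive upper limit into growth of the ramp potential.\<close>

lemma potential_ramp_diff_ge:
  assumes "0 < y" "y \<le> x"
  shows "(1 - y / x) * potential bump x \<le> potential ramp x - potential ramp y"
proof -
  have s: "summable (\<lambda>k. (step ^^ k) bump x)" "summable (\<lambda>k. (step ^^ k) ramp x)"
    "summable (\<lambda>k. (step ^^ k) ramp y)"
    using assms by (intro bump_potential(1) ramp_potential(1); simp)+
  show ?thesis
    unfolding potential_def suminf_diff[OF s(2,3)] suminf_mult[OF s(1), symmetric]
    using assms s by (intro suminf_le summable_diff summable_mult ramp_pow_diff_ge) auto
qed

lemma potential_ramp_mono: "0 < y \<Longrightarrow> y \<le> x \<Longrightarrow> potential ramp y \<le> potential ramp x"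
  using potential_ramp_diff_ge[of y x] bump_potential(2)[of x]
  by (smt (verit) divide_le_eq_1 mult_nonneg_nonneg)

text \<open>\<open>ramp\<close> is a bounded supersolution of the renewal equation, by \<open>ramp_pow_diff_ge\<close> with \<open>y = x * W\<close>.\<close>

lemma potential_bump_le:
  assumes "0 \<le> x" shows "potential bump x \<le> 2 / (1 - expectation W)"
proof (cases "x = 0")
  case True
  then show ?thesis
    using bump_potential(3)[of 0] expectation_factor_less_1 by (auto intro: order_trans[of _ 0])
next
  case False
  then have "0 < x" using assms by simp
  let ?m = "expectation W"
  have *: "(1 - ?m) * (step ^^ k) bump x \<le> (step ^^ k) ramp x - (step ^^ Suc k) ramp x" for k
  proof -
    have "(1 - ?m) * (step ^^ k) bump x = expectation (\<lambda>\<omega>. (1 - W \<omega>) * (step ^^ k) bump x)"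
      by (simp add: prob_space)
    also have "\<dots> \<le> expectation (\<lambda>\<omega>. (step ^^ k) ramp x - (step ^^ k) ramp (x * W \<omega>))"
    proof (intro integral_mono integrable_mult_left Bochner_Integration.integrable_diff
        ramp_pow_integrable integrable_const integrable_factor)
      fix \<omega> assume "\<omega> \<in> space M"
      then have "0 < x * W \<omega>" "x * W \<omega> \<le> x"
        using factor_range[of \<omega>] \<open>0 < x\<close> by (auto simp: mult_left_le)
      then show "(1 - W \<omega>) * (step ^^ k) bump x \<le> (step ^^ k) ramp x - (step ^^ k) ramp (x * W \<omega>)"
        using ramp_pow_diff_ge[of "x * W \<omega>" x k] \<open>0 < x\<close> by simp
    qed
    also have "\<dots> = (step ^^ k) ramp x - (step ^^ Suc k) ramp x"
      unfolding step_pow_Suc by (simp add: ramp_pow_integrable prob_space)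
    finally show ?thesis .
  qed
  have "(1 - ?m) * (\<Sum>k<K. (step ^^ k) bump x) \<le> 2" for K
  proof -
    have "(1 - ?m) * (\<Sum>k<K. (step ^^ k) bump x)
        \<le> (\<Sum>k<K. (step ^^ k) ramp x - (step ^^ Suc k) ramp x)"
      unfolding sum_distrib_left by (intro sum_mono *)
    also have "\<dots> = ramp x - (step ^^ K) ramp x"
      using sum_lessThan_telescope'[of "\<lambda>k. (step ^^ k) ramp x" K] by (simp del: funpow.simps(2))
    also have "\<dots> \<le> 2"
      using step_pow_bounds[OF ramp_measurable ramp_bounds(1,2), of K x] ramp_bounds(2)[of x] by simp
    finally show ?thesis .
  qed
  then have "(\<Sum>k<K. (step ^^ k) bump x) \<le> 2 / (1 - ?m)" for K
    using expectation_factor_less_1 by (simp add: pos_le_divide_eq mult.commute)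
  then show ?thesis
    unfolding potential_def using bump_potential(1)[OF assms] by (intro suminf_le_const) auto
qed

section \<open>Near-maximal points of the bump potential and chains of them\<close>

text \<open>Continuity from above, as \<open>W\<close> is positive. It serves to discard the event
  that \<open>x * W \<omega>\<close> falls back below the range in which the potential is near its
  upper limit.\<close>

lemma prob_factor_less_small:
  assumes "0 < e"
  shows "\<exists>d>0. prob {\<omega> \<in> space M. W \<omega> < d} < e"
proof -
  let ?A = "\<lambda>j::nat. {\<omega> \<in> space M. W \<omega> < 1 / Suc j}"
  have "(\<lambda>j. prob (?A j)) \<longlonglongrightarrow> prob (\<Inter>j. ?A j)"
  proof (rule finite_Lim_measure_decseq)
    have "1 / real (Suc n) \<le> 1 / real (Suc m)" if "m \<le> n" for m n
      using that by (simp add: frac_le)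
    then show "decseq ?A"
      unfolding decseq_def by (blast intro: order_less_le_trans)
  qed auto
  moreover have "(\<Inter>j. ?A j) = {}"
  proof safe
    fix \<omega> assume *: "\<omega> \<in> (\<Inter>j. ?A j)"
    then have "0 < W \<omega>" using factor_pos by auto
    then obtain j where "1 / real (Suc j) < W \<omega>"
      using nat_approx_posE by metis
    then show "\<omega> \<in> {}" using * by (auto dest!: spec[of _ j])
  qed
  ultimately have "(\<lambda>j. prob (?A j)) \<longlonglongrightarrow> 0" by simp
  then have "eventually (\<lambda>j. prob (?A j) < e) sequentially"
    using assms by (rule order_tendstoD)
  then obtain j where "prob (?A j) < e"
    by (auto simp: eventually_sequentially)
  then show ?thesis by (intro exI[of _ "1 / Suc j"]) auto
qed

text \<open>The intervals \<open>{1 / (j + 2) .. 1 - 1 / (j + 2)}\<close> exhaust the unit interval,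
  so one of them has positive mass. In a chain, \<open>q < 1\<close> forces a drop at each step and
  \<open>0 < r\<close> limits the length of a step.\<close>

lemma factor_concentrated:
  obtains r q where "0 < r" "r \<le> q" "q < 1" "0 < prob {\<omega> \<in> space M. W \<omega> \<in> {r..q}}"
proof -
  let ?A = "\<lambda>j::nat. {\<omega> \<in> space M. W \<omega> \<in> {1 / (j + 2) .. 1 - 1 / (j + 2)}}"
  have "\<exists>j. 0 < prob (?A j)"
  proof (rule ccontr)
    assume "\<not> ?thesis"
    then have "?A j \<in> null_sets M" for j
      by (auto simp: emeasure_eq_measure null_sets_def not_less antisym[OF _ measure_nonneg])
    then have "(\<Union>j. ?A j) \<in> null_sets M" by (intro null_sets_UN)
    moreover have "(\<Union>j. ?A j) = space M"
    proof safe
      fix \<omega> assume \<omega>: "\<omega> \<in> space M"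
      then obtain j where j: "1 / real (Suc j) < min (W \<omega>) (1 - W \<omega>)"
        using nat_approx_posE[of "min (W \<omega>) (1 - W \<omega>)"] factor_range by auto
      moreover have "1 / (real j + 2) \<le> 1 / real (Suc j)" by (simp add: field_simps)
      ultimately show "\<omega> \<in> (\<Union>j. ?A j)" using \<omega> by (auto intro!: exI[of _ j])
    qed
    ultimately show False using emeasure_space_1 by (simp add: null_sets_def)
  qed
  then obtain j where "0 < prob (?A j)" ..
  then show thesis by (intro that[of "1 / (j + 2)" "1 - 1 / (j + 2)"]) (auto simp: field_simps)
qed

text \<open>By the renewal equation, the potential at a large \<open>x\<close> is almost the average
  of its values at \<open>x * W \<omega>\<close>, nearly all of which are at most
  \<open>h + d\<close>. An average close to \<open>h\<close> then leaves no room for values below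
  \<open>h - e\<close> on the whole window \<open>{r..q}\<close>, which has positive
  probability.\<close>

lemma potential_bump_backstep:
  assumes r: "0 < r" and p: "0 < prob {\<omega> \<in> space M. W \<omega> \<in> {r..q}}"
    and top: "\<And>d. 0 < d \<Longrightarrow> eventually (\<lambda>x. potential bump x \<le> h + d) at_top"
    and "0 < e"
  shows "\<exists>d>0. \<exists>X>0. \<forall>x\<ge>X. h - d \<le> potential bump x \<longrightarrow> (\<exists>w\<in>{r..q}. h - e \<le> potential bump (x * w))"
proof -
  let ?z = "potential bump"
  let ?B = "{\<omega> \<in> space M. W \<omega> \<in> {r..q}}"
  define p where "p = prob ?B"
  define C where "C = 2 / (1 - expectation W)"
  have "0 < C" using expectation_factor_less_1 by (simp add: C_def)
  \<comment> \<open>The errors below lead to \<open>e * p \<le> 4 * d\<close>, which this choice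
    contradicts.\<close>
  define d where "d = p * e / 5"
  have "0 < d" using p \<open>0 < e\<close> by (simp add: d_def p_def)
  obtain X1 where X1: "\<And>x. X1 \<le> x \<Longrightarrow> ?z x \<le> h + d"
    using top[OF \<open>0 < d\<close>] by (auto simp: eventually_at_top_linorder)
  obtain y where "0 < y" and y: "prob {\<omega> \<in> space M. W \<omega> < y} < d / (C + \<bar>h\<bar> + d)"
    using prob_factor_less_small[of "d / (C + \<bar>h\<bar> + d)"] \<open>0 < d\<close> \<open>0 < C\<close> by auto
  let ?S = "{\<omega> \<in> space M. W \<omega> < y}"
  \<comment> \<open>The three bounds give \<open>x > 0\<close>, \<open>bump x \<le> d\<close>, and
    \<open>X1 \<le> x * W \<omega>\<close> whenever \<open>W \<omega> \<ge> y\<close>.\<close>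
  define X where "X = max 1 (max (1 / d) (X1 / y))"
  show ?thesis
  proof (rule exI[of _ d], intro conjI, fact, rule exI[of _ X], intro conjI allI impI)
    show "0 < X" by (simp add: X_def)
    fix x assume "X \<le> x" and zx: "h - d \<le> ?z x"
    then have x: "1 \<le> x" "1 / d \<le> x" "X1 / y \<le> x" by (simp_all add: X_def)
    have "0 < x" using x by simp
    show "\<exists>w\<in>{r..q}. h - e \<le> ?z (x * w)"
    proof (rule ccontr)
      assume "\<not> ?thesis"
      then have B: "?z (x * w) < h - e" if "w \<in> {r..q}" for w
        using that by (auto simp: not_le)
      \<comment> \<open>Three regimes: below \<open>h - e\<close> on the window \<open>?B\<close>,
        at most \<open>h + d\<close> outside \<open>?S\<close>, and at most the uniform bound
        \<open>C\<close> on \<open>?S\<close>. The summand \<open>\<bar>h\<bar>\<close> makes the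
        coefficient of \<open>?S\<close> large enough for either sign of \<open>h\<close>;
        \<open>y\<close> was chosen so that this term contributes at most \<open>d\<close>.\<close>
      have "?z (x * W \<omega>) \<le> (h + d) - (e + d) * indicator ?B \<omega> + (C + \<bar>h\<bar> + d) * indicator ?S \<omega>"
        if \<omega>: "\<omega> \<in> space M" for \<omega>
      proof (cases "\<omega> \<in> ?B")
        case True
        then show ?thesis
          using B[of "W \<omega>"] \<open>0 < d\<close> \<open>0 < C\<close> by (auto simp: indicator_def)
      next
        case False
        show ?thesis
        proof (cases "\<omega> \<in> ?S")
          case True
          have "?z (x * W \<omega>) \<le> C"
            unfolding C_def using factor_pos[OF \<omega>] \<open>0 < x\<close> by (intro potential_bump_le) auto
          then show ?thesis using True False \<open>0 < d\<close> \<open>0 < C\<close> by (auto simp: indicator_def)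
        next
          case S: False
          then have "X1 \<le> x * y" "y \<le> W \<omega>" using x \<open>0 < y\<close> \<omega> by (auto simp: field_simps)
          then have "X1 \<le> x * W \<omega>"
            using \<open>0 < x\<close> by (meson mult_left_mono less_imp_le order_trans)
          then have "?z (x * W \<omega>) \<le> h + d" by (rule X1)
          then show ?thesis using S False by simp
        qed
      qed
      then have "expectation (\<lambda>\<omega>. ?z (x * W \<omega>))
          \<le> expectation (\<lambda>\<omega>. (h + d) - (e + d) * indicator ?B \<omega> + (C + \<bar>h\<bar> + d) * indicator ?S \<omega>)"
        using \<open>0 < x\<close> by (intro integral_mono bump_potential(4)) (auto simp: emeasure_eq_measure)
      also have "\<dots> = h + d - (e + d) * p + (C + \<bar>h\<bar> + d) * prob ?S"
        by (subst Bochner_Integration.integral_add)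
           (auto simp: emeasure_eq_measure prob_space p_def Bochner_Integration.integral_diff)
      also have "\<dots> \<le> h + d - e * p + d"
      proof -
        have "(C + \<bar>h\<bar> + d) * prob ?S \<le> d"
          using y \<open>0 < d\<close> \<open>0 < C\<close> by (simp add: field_simps)
        moreover have "0 \<le> d * p" using \<open>0 < d\<close> p by (simp add: p_def)
        ultimately show ?thesis by (simp add: algebra_simps)
      qed
      finally have "?z x \<le> bump x + h + 2 * d - e * p"
        using bump_potential(5)[of x] \<open>0 < x\<close> by simp
      moreover have "bump x \<le> d"
        using bump_bounds(4)[of x] x \<open>0 < x\<close> \<open>0 < d\<close>
        by (smt (verit, best) divide_le_eq mult.commute)
      ultimately have "h - d \<le> h + 3 * d - e * p" using zx by simp
      then show False using \<open>0 < d\<close> by (simp add: d_def mult.commute)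
    qed
  qed
qed

text \<open>Along a geometric chain that stays near the upper limit \<open>h\<close> of the bump potential, the ramp potential
  drops by a fixed amount in each step.\<close>

lemma potential_chain:
  assumes r: "0 < r" "q < 1" and p: "0 < prob {\<omega> \<in> space M. W \<omega> \<in> {r..q}}"
    and top: "\<And>d. 0 < d \<Longrightarrow> eventually (\<lambda>x. potential bump x \<le> h + d) at_top"
    and freq: "\<And>d. 0 < d \<Longrightarrow> frequently (\<lambda>x. h - d \<le> potential bump x) at_top"
    and "0 < h"
  shows "0 < e \<Longrightarrow> \<exists>x>0. \<exists>y\<ge>X. x * r ^ J \<le> y \<and> y \<le> x \<and> h - e \<le> potential bump y \<and>
    (\<forall>j\<le>J. real j * ((1 - q) * (h / 2)) \<le> potential ramp x - potential ramp (x * r ^ j)) \<and>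
    real J * ((1 - q) * (h / 2)) \<le> potential ramp x - potential ramp y"
proof (induction J arbitrary: e X)
  case 0
  have "\<exists>x. max X 1 \<le> x \<and> h - e \<le> potential bump x"
    using freq[OF 0] unfolding frequently_def eventually_at_top_linorder by blast
  then obtain x where "max X 1 \<le> x" "h - e \<le> potential bump x" by blast
  then show ?case by (auto intro!: exI[of _ x])
next
  case (Suc J)
  let ?z = "potential bump" and ?A = "potential ramp" and ?k = "(1 - q) * (h / 2)"
  obtain d X1 where "0 < d" "0 < X1"
    and backstep: "\<And>x. X1 \<le> x \<Longrightarrow> h - d \<le> ?z x \<Longrightarrow> \<exists>w\<in>{r..q}. h - e \<le> ?z (x * w)"
    using potential_bump_backstep[OF r(1) p top Suc.prems] by blast
  \<comment> \<open>The shorter chain is taken with stricter demands. Tolerance \<open>d\<close> and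
    threshold \<open>X1\<close> allow one more backstep from \<open>y\<close>, tolerance
    \<open>h / 2\<close> gives that step a drop of fixed size, and threshold
    \<open>\<bar>X\<bar> / r\<close> keeps \<open>y * w\<close> above \<open>X\<close>, since
    \<open>w \<ge> r\<close>.\<close>
  obtain x y where "0 < x" and y: "max X1 (\<bar>X\<bar> / r) \<le> y" "x * r ^ J \<le> y" "y \<le> x" "h - min d (h / 2) \<le> ?z y"
    and A: "\<And>j. j \<le> J \<Longrightarrow> real j * ?k \<le> ?A x - ?A (x * r ^ j)" "real J * ?k \<le> ?A x - ?A y"
    using Suc.IH[of "min d (h / 2)" "max X1 (\<bar>X\<bar> / r)"] \<open>0 < d\<close> \<open>0 < h\<close> by auto
  have zy: "h - d \<le> ?z y" "h / 2 \<le> ?z y"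
    using y(4) by linarith+
  obtain w where w: "w \<in> {r..q}" "h - e \<le> ?z (y * w)"
    using backstep[of y] y zy by auto
  have "0 < y" using y \<open>0 < X1\<close> by simp
  have "y * r \<le> y * w" "y * w \<le> y" "0 < w"
    using w r \<open>0 < y\<close> by (auto simp: mult_left_le)
  have drop: "?k \<le> ?A y - ?A (y * w)"
  proof -
    have "?k \<le> (1 - w) * ?z y"
      using w r zy \<open>0 < h\<close> by (intro mult_mono) auto
    also have "\<dots> \<le> ?A y - ?A (y * w)"
      using potential_ramp_diff_ge[of "y * w" y] \<open>0 < y\<close> \<open>0 < w\<close> \<open>y * w \<le> y\<close> by simp
    finally show ?thesis .
  qed
  have le: "x * r ^ Suc J \<le> y * w"
  proof -
    have "x * r ^ J * r \<le> y * r" using y r by (intro mult_right_mono) auto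
    then show ?thesis using \<open>y * r \<le> y * w\<close> by (simp add: mult_ac)
  qed
  have last: "real (Suc J) * ?k \<le> ?A x - ?A (y * w)"
    using drop A(2) unfolding of_nat_Suc distrib_right by linarith
  \<comment> \<open>Monotonicity moves the drop from the chain point \<open>y * w\<close>, whose
    position is uncontrolled, to the fixed power \<open>x * r ^ Suc J\<close> below it.\<close>
  have last': "real (Suc J) * ?k \<le> ?A x - ?A (x * r ^ Suc J)"
    using last potential_ramp_mono[OF _ le] \<open>0 < x\<close> r by simp
  have "X \<le> y * w"
    using y r \<open>y * r \<le> y * w\<close> by (auto simp: field_simps)
  then show ?case
    using \<open>0 < x\<close> le y \<open>y * w \<le> y\<close> w A(1) last last'
    by (intro exI[of _ x] conjI exI[of _ "y * w"]) (auto simp: le_Suc_eq simp del: of_nat_Suc power_Suc)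
qed

text \<open>If \<open>W \<omega> \<le> r ^ j\<close>, then the ramp potential drops by at least
  \<open>j * k\<close> from \<open>x\<close> to \<open>x * W \<omega>\<close>. The renewal equation
  makes the expected drop equal to \<open>ramp x \<le> 2\<close>, a bound free of both
  \<open>x\<close> and \<open>J\<close>.\<close>

lemma truncated_log_bound:
  assumes r: "0 < r" "r < 1" and "0 < k" "0 < x"
    and A: "\<And>j. j \<le> J \<Longrightarrow> real j * k \<le> potential ramp x - potential ramp (x * r ^ j)"
  shows "(\<integral>\<^sup>+\<omega>. ennreal (min (real J) (\<bar>ln (W \<omega>)\<bar> / \<bar>ln r\<bar> - 1)) \<partial>M) \<le> ennreal (2 / k)"
proof -
  let ?A = "potential ramp"
  let ?f = "\<lambda>\<omega>. min (real J) (\<bar>ln (W \<omega>)\<bar> / \<bar>ln r\<bar> - 1)"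
  have int: "integrable M (\<lambda>\<omega>. ?A x - ?A (x * W \<omega>))"
    using \<open>0 < x\<close> by (intro Bochner_Integration.integrable_diff ramp_potential(4)) auto
  have "k * ?f \<omega> \<le> ?A x - ?A (x * W \<omega>)" "0 \<le> ?A x - ?A (x * W \<omega>)" if \<omega>: "\<omega> \<in> space M" for \<omega>
  proof -
    have W: "0 < W \<omega>" "W \<omega> < 1" using factor_range[OF \<omega>] by auto
    let ?t = "\<bar>ln (W \<omega>)\<bar> / \<bar>ln r\<bar>"
    \<comment> \<open>The largest \<open>j \<le> J\<close> with
      \<open>W \<omega> \<le> r ^ j\<close>. Rounding down loses less than 1, hence the
      \<open>- 1\<close> in \<open>?f\<close>.\<close>
    define j where "j = min J (nat \<lfloor>?t\<rfloor>)"
    have "0 < \<bar>ln r\<bar>" using r by simp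
    have "0 \<le> ?t" by simp
    then have "real (nat \<lfloor>?t\<rfloor>) \<le> ?t" by linarith
    moreover have "real j \<le> real (nat \<lfloor>?t\<rfloor>)" unfolding j_def by (intro of_nat_mono min.cobounded2)
    ultimately have "real j \<le> ?t" by linarith
    then have "real j * \<bar>ln r\<bar> \<le> \<bar>ln (W \<omega>)\<bar>" using \<open>0 < \<bar>ln r\<bar>\<close> by (simp add: field_simps)
    then have "ln (W \<omega>) \<le> ln (r ^ j)" using W r by (simp add: ln_realpow)
    then have "W \<omega> \<le> r ^ j" using W r by (subst (asm) ln_le_cancel_iff) auto
    then have "?A (x * W \<omega>) \<le> ?A (x * r ^ j)"
      using \<open>0 < x\<close> W by (intro potential_ramp_mono mult_left_mono) auto
    then have "real j * k \<le> ?A x - ?A (x * W \<omega>)"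
      using A[of j] by (simp add: j_def)
    moreover have "?f \<omega> \<le> real j"
      using \<open>0 \<le> ?t\<close> unfolding j_def by linarith
    then have "k * ?f \<omega> \<le> real j * k"
      using \<open>0 < k\<close> by (simp add: mult.commute)
    ultimately show "k * ?f \<omega> \<le> ?A x - ?A (x * W \<omega>)" by simp
    show "0 \<le> ?A x - ?A (x * W \<omega>)"
      using \<open>0 < x\<close> W by (simp add: mult_left_le potential_ramp_mono)
  qed
  then have "(\<integral>\<^sup>+\<omega>. ennreal (?f \<omega>) \<partial>M) \<le> (\<integral>\<^sup>+\<omega>. ennreal ((?A x - ?A (x * W \<omega>)) / k) \<partial>M)"
    using \<open>0 < k\<close> by (intro nn_integral_mono ennreal_leI) (simp add: field_simps)
  also have "\<dots> = ennreal (expectation (\<lambda>\<omega>. (?A x - ?A (x * W \<omega>)) / k))"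
    using int \<open>\<And>\<omega>. \<omega> \<in> space M \<Longrightarrow> 0 \<le> ?A x - ?A (x * W \<omega>)\<close> \<open>0 < k\<close>
    by (intro nn_integral_eq_integral) auto
  also have "expectation (\<lambda>\<omega>. (?A x - ?A (x * W \<omega>)) / k) = ramp x / k"
    using ramp_potential(4,5)[of x] \<open>0 < x\<close> by (simp add: prob_space)
  also have "ennreal (ramp x / k) \<le> ennreal (2 / k)"
    using ramp_bounds(2)[of x] \<open>0 < k\<close> by (intro ennreal_leI divide_right_mono) auto
  finally show ?thesis .
qed

text \<open>If the upper limit \<open>h\<close> were positive, chains of every length
  \<open>J\<close> would exist with the same \<open>r\<close> and \<open>k\<close>, only
  \<open>x\<close> depending on \<open>J\<close>. The truncated bounds are then uniform in
  \<open>J\<close>, and monotone convergence makes the expectation of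
  \<open>\<bar>ln (W \<omega>)\<bar>\<close> finite.\<close>

theorem potential_bump_tendsto_0:
  assumes inf: "(\<integral>\<^sup>+\<omega>. ennreal \<bar>ln (W \<omega>)\<bar> \<partial>M) = \<infinity>"
  shows "(potential bump \<longlongrightarrow> 0) at_top"
proof -
  let ?z = "potential bump"
  \<comment> \<open>The infimum of the eventual upper bounds is the upper limit of \<open>?z\<close>
    at infinity.\<close>
  define Y where "Y = {y. eventually (\<lambda>x. ?z x \<le> y) at_top}"
  define h where "h = Inf Y"
  have "2 / (1 - expectation W) \<in> Y"
    unfolding Y_def
    using eventually_mono[OF eventually_ge_at_top[of "0 :: real"] potential_bump_le] by simp
  then have "Y \<noteq> {}" by auto
  have Y0: "0 \<le> y" if "y \<in> Y" for y
  proof -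
    have "eventually (\<lambda>x. ?z x \<le> y \<and> 0 \<le> x) at_top"
      using that eventually_ge_at_top[of 0] by (auto simp: Y_def intro: eventually_conj)
    then obtain x where "?z x \<le> y" "0 \<le> x"
      using eventually_happens[of _ "at_top :: real filter"] by auto
    then show ?thesis using bump_potential(2)[of x] by simp
  qed
  then have bdd: "bdd_below Y" by (meson bdd_belowI)
  have top: "eventually (\<lambda>x. ?z x \<le> h + d) at_top" if "0 < d" for d
  proof -
    obtain y where "y \<in> Y" "y < h + d"
      using cInf_lessD[OF \<open>Y \<noteq> {}\<close>, of "h + d"] \<open>0 < d\<close> by (auto simp: h_def)
    then show ?thesis by (auto simp: Y_def elim: eventually_mono)
  qed
  have freq: "frequently (\<lambda>x. h - d \<le> ?z x) at_top" if "0 < d" for d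
  proof (rule ccontr)
    assume "\<not> ?thesis"
    then have "h - d \<in> Y"
      by (auto simp: frequently_def Y_def not_le elim: eventually_mono)
    then show False using cInf_lower[OF _ bdd, of "h - d"] that by (simp add: h_def)
  qed
  have "h \<le> 0"
  proof (rule ccontr)
    assume "\<not> h \<le> 0"
    then have "0 < h" by simp
    obtain r q where rq: "0 < r" "r \<le> q" "q < 1" "0 < prob {\<omega> \<in> space M. W \<omega> \<in> {r..q}}"
      by (rule factor_concentrated)
    define k where "k = (1 - q) * (h / 2)"
    have "0 < k" using rq \<open>0 < h\<close> by (simp add: k_def)
    let ?g = "\<lambda>\<omega>. \<bar>ln (W \<omega>)\<bar> / \<bar>ln r\<bar> - 1"
    have "(\<integral>\<^sup>+\<omega>. ennreal (min (real J) (?g \<omega>)) \<partial>M) \<le> ennreal (2 / k)" for J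
    proof -
      obtain x where "0 < x"
        and "\<And>j. j \<le> J \<Longrightarrow> real j * k \<le> potential ramp x - potential ramp (x * r ^ j)"
        using potential_chain[OF rq(1,3,4) top freq \<open>0 < h\<close>, of 1 0 J] unfolding k_def by auto
      then show ?thesis using rq \<open>0 < k\<close> by (intro truncated_log_bound) auto
    qed
    then have "(SUP J. \<integral>\<^sup>+\<omega>. ennreal (min (real J) (?g \<omega>)) \<partial>M) \<le> ennreal (2 / k)"
      by (intro SUP_least)
    also have "(SUP J. \<integral>\<^sup>+\<omega>. ennreal (min (real J) (?g \<omega>)) \<partial>M) = (\<integral>\<^sup>+\<omega>. (SUP J. ennreal (min (real J) (?g \<omega>))) \<partial>M)"
      by (intro nn_integral_monotone_convergence_SUP[symmetric])
         (auto simp: incseq_def le_fun_def intro!: ennreal_leI min.mono)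
    finally have le: "(\<integral>\<^sup>+\<omega>. (SUP J. ennreal (min (real J) (?g \<omega>))) \<partial>M) \<le> ennreal (2 / k)" .
    have "0 < \<bar>ln r\<bar>" using rq by simp
    \<comment> \<open>This undoes the normalisation in \<open>?g\<close>. Where \<open>?g\<close> is
      negative, \<open>ennreal\<close> turns it into 0 and the added 1 still dominates.\<close>
    have pt: "ennreal \<bar>ln (W \<omega>)\<bar> \<le> ennreal \<bar>ln r\<bar> * ((SUP J. ennreal (min (real J) (?g \<omega>))) + 1)" for \<omega>
    proof -
      obtain J where "?g \<omega> \<le> real J" using real_arch_simple by blast
      then have "ennreal (?g \<omega>) \<le> (SUP J. ennreal (min (real J) (?g \<omega>)))"
        by (intro SUP_upper2[of J]) auto
      then have "ennreal (?g \<omega>) + 1 \<le> (SUP J. ennreal (min (real J) (?g \<omega>))) + 1"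
        by (intro add_right_mono)
      moreover have "ennreal (\<bar>ln (W \<omega>)\<bar> / \<bar>ln r\<bar>) \<le> ennreal (?g \<omega>) + 1"
        by (cases "0 \<le> ?g \<omega>") (auto simp: ennreal_neg ennreal_plus[symmetric] ennreal_1[symmetric]
            simp del: ennreal_plus ennreal_1 intro!: ennreal_leI)
      ultimately have "ennreal (\<bar>ln (W \<omega>)\<bar> / \<bar>ln r\<bar>) \<le> (SUP J. ennreal (min (real J) (?g \<omega>))) + 1"
        by (rule order_trans[rotated])
      then have "ennreal \<bar>ln r\<bar> * ennreal (\<bar>ln (W \<omega>)\<bar> / \<bar>ln r\<bar>)
          \<le> ennreal \<bar>ln r\<bar> * ((SUP J. ennreal (min (real J) (?g \<omega>))) + 1)"
        by (intro mult_left_mono) auto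
      then show ?thesis using \<open>0 < \<bar>ln r\<bar>\<close> by (simp add: ennreal_mult[symmetric])
    qed
    have "(\<integral>\<^sup>+\<omega>. ennreal \<bar>ln (W \<omega>)\<bar> \<partial>M)
        \<le> (\<integral>\<^sup>+\<omega>. ennreal \<bar>ln r\<bar> * ((SUP J. ennreal (min (real J) (?g \<omega>))) + 1) \<partial>M)"
      by (intro nn_integral_mono pt)
    also have "\<dots> = ennreal \<bar>ln r\<bar> * ((\<integral>\<^sup>+\<omega>. (SUP J. ennreal (min (real J) (?g \<omega>))) \<partial>M) + 1)"
      by (simp add: nn_integral_cmult nn_integral_add emeasure_space_1)
    also have "\<dots> \<le> ennreal \<bar>ln r\<bar> * (ennreal (2 / k) + 1)"
      by (intro mult_left_mono add_right_mono le) auto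
    also have "\<dots> < \<infinity>"
      by (simp add: ennreal_mult_less_top)
    finally show False using inf by simp
  qed
  show ?thesis
  proof (rule order_tendstoI)
    fix a :: real assume "a < 0"
    then have *: "a < ?z x" if "0 \<le> x" for x
      using bump_potential(2)[OF that] by simp
    show "eventually (\<lambda>x. a < ?z x) at_top"
      by (rule eventually_mono[OF eventually_ge_at_top[of 0] *])
  next
    fix a :: real assume "0 < a"
    then show "eventually (\<lambda>x. ?z x < a) at_top"
      using top[of "a / 2"] \<open>h \<le> 0\<close> by (auto elim!: eventually_mono)
  qed
qed

end

section \<open>Independence in the sieve\<close>

lemma Inl_in_Plus_iff [simp]: "Inl a \<in> A <+> B \<longleftrightarrow> a \<in> A"
  and Inr_in_Plus_iff [simp]: "Inr b \<in> A <+> B \<longleftrightarrow> b \<in> B"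
  by auto

text \<open>Independence makes the joint law a product measure, so Fubini applies. The second
  integration runs over a fresh outcome \<open>\<omega>'\<close>, which expresses conditioning on
  \<open>X\<close> without conditional expectations.\<close>

lemma (in prob_space) indep_var_fubini:
  fixes h :: "'b \<Rightarrow> 'b \<Rightarrow> 'd::{banach, second_countable_topology}"
  assumes ind: "indep_var S X T Y"
    and h: "case_prod h \<in> borel_measurable (S \<Otimes>\<^sub>M T)"
    and bnd: "\<And>x y. norm (h x y) \<le> B"
  shows "expectation (\<lambda>\<omega>. h (X \<omega>) (Y \<omega>)) = expectation (\<lambda>\<omega>. expectation (\<lambda>\<omega>'. h (X \<omega>) (Y \<omega>')))"
proof -
  have X [measurable]: "random_variable S X" and Y [measurable]: "random_variable T Y"
    and joint: "distr M S X \<Otimes>\<^sub>M distr M T Y = distr M (S \<Otimes>\<^sub>M T) (\<lambda>\<omega>. (X \<omega>, Y \<omega>))"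
    using ind unfolding indep_var_distribution_eq by auto
  note [measurable] = h
  interpret X: prob_space "distr M S X" by (rule prob_space_distr) fact
  interpret Y: prob_space "distr M T Y" by (rule prob_space_distr) fact
  interpret XY: pair_prob_space "distr M S X" "distr M T Y" ..
  have int: "integrable (distr M S X \<Otimes>\<^sub>M distr M T Y) (case_prod h)"
    using bnd by (intro XY.integrable_const_bound[of _ B]) (auto simp: split_beta)
  have "expectation (\<lambda>\<omega>. h (X \<omega>) (Y \<omega>))
      = integral\<^sup>L (distr M (S \<Otimes>\<^sub>M T) (\<lambda>\<omega>. (X \<omega>, Y \<omega>))) (case_prod h)"
    by (subst integral_distr) auto
  also have "\<dots> = (\<integral>x. (\<integral>y. h x y \<partial>distr M T Y) \<partial>distr M S X)"
    unfolding joint[symmetric] using XY.integral_fst'[OF int] by simp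
  also have "\<dots> = expectation (\<lambda>\<omega>. \<integral>y. h (X \<omega>) y \<partial>distr M T Y)"
    by (subst integral_distr) auto
  also have "\<dots> = expectation (\<lambda>\<omega>. expectation (\<lambda>\<omega>'. h (X \<omega>) (Y \<omega>')))"
  proof (rule Bochner_Integration.integral_cong[OF refl])
    fix \<omega> assume "\<omega> \<in> space M"
    then have "X \<omega> \<in> space S" by (rule measurable_space[OF X])
    then have "h (X \<omega>) \<in> borel_measurable T"
      using measurable_Pair2[OF h] by simp
    then show "(\<integral>y. h (X \<omega>) y \<partial>distr M T Y) = expectation (\<lambda>\<omega>'. h (X \<omega>) (Y \<omega>'))"
      by (intro integral_distr Y)
  qed
  finally show ?thesis .
qed

sublocale bernoulli_sieve \<subseteq> unit_factor M W
  by unfold_locales (rule W_measurable, rule W_range)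

context bernoulli_sieve begin

section \<open>Regular outcomes and the uniform balls\<close>

lemma Ws_measurable: "1 \<le> k \<Longrightarrow> random_variable borel (Ws k)"
  using Ws_indep by (auto simp: indep_vars_def2)

lemma U_measurable: "1 \<le> i \<Longrightarrow> random_variable borel (U i)"
  using U_indep by (auto simp: indep_vars_def2)

lemma sieve_T_measurable [measurable]: "random_variable borel (sieve_T Ws k)"
  unfolding sieve_T_def[abs_def] by (intro borel_measurable_prod Ws_measurable) auto

lemma expectation_Ws:
  fixes f :: "real \<Rightarrow> 'c::{banach, second_countable_topology}"
  assumes "1 \<le> k" and [measurable]: "f \<in> borel_measurable borel"
  shows "expectation (\<lambda>\<omega>. f (Ws k \<omega>)) = expectation (\<lambda>\<omega>. f (W \<omega>))"
proof -
  have "expectation (\<lambda>\<omega>. f (Ws k \<omega>)) = integral\<^sup>L (distr M borel (Ws k)) f"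
    using Ws_measurable[OF assms(1)] by (subst integral_distr) auto
  also have "\<dots> = expectation (\<lambda>\<omega>. f (W \<omega>))"
    unfolding Ws_copies[OF assms(1)] by (subst integral_distr) auto
  finally show ?thesis .
qed

lemma AE_Ws: "1 \<le> k \<Longrightarrow> AE \<omega> in M. Ws k \<omega> \<in> {0<..<1}"
proof -
  assume k: "1 \<le> k"
  have "AE x in distr M borel W. x \<in> {0<..<1}"
    by (subst AE_distr_iff) (use W_range in auto)
  then show ?thesis
    unfolding Ws_copies[OF k, symmetric] using Ws_measurable[OF k] by (subst (asm) AE_distr_iff) auto
qed

lemma AE_U: "1 \<le> i \<Longrightarrow> AE \<omega> in M. U i \<omega> \<in> {0<..1}"
proof -
  assume i: "1 \<le> i"
  have "AE x in uniform_measure lborel {0..1}. x \<in> {0<..1::real}"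
  proof (rule AE_uniform_measureI)
    show "AE x in lborel. x \<in> {0..1} \<longrightarrow> x \<in> {0<..1::real}"
      using AE_lborel_singleton[of "0::real"] by (auto elim!: eventually_mono)
  qed auto
  then show ?thesis
    unfolding U_uniform[OF i, symmetric] using U_measurable[OF i] by (subst (asm) AE_distr_iff) auto
qed

text \<open>One almost sure event collecting all pathwise properties, since the copies and the balls
  are known only through their laws. The value 0 is excluded for balls because it lies in no
  box.\<close>

definition regular :: "'a \<Rightarrow> bool" where
  "regular \<omega> \<longleftrightarrow> (\<forall>k\<ge>1. Ws k \<omega> \<in> {0<..<1} \<and> U k \<omega> \<in> {0<..1})"

lemma AE_regular: "AE \<omega> in M. regular \<omega>"
  unfolding regular_def using AE_Ws AE_U by (auto simp: AE_all_countable)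

lemma sieve_T_Suc: "sieve_T Ws (Suc k) \<omega> = sieve_T Ws k \<omega> * Ws (Suc k) \<omega>"
  by (simp add: sieve_T_def prod.nat_ivl_Suc')

lemma sieve_T_bounds: "regular \<omega> \<Longrightarrow> 0 < sieve_T Ws k \<omega> \<and> sieve_T Ws k \<omega> \<le> 1"
  unfolding sieve_T_def regular_def
  by (intro conjI prod_pos prod_le_1 ballI) (auto intro: less_imp_le)

lemma sieve_T_antimono:
  assumes "regular \<omega>" "j \<le> k" shows "sieve_T Ws k \<omega> \<le> sieve_T Ws j \<omega>"
  using assms(2)
proof (induction rule: dec_induct)
  case (step k)
  have "sieve_T Ws k \<omega> * Ws (Suc k) \<omega> \<le> sieve_T Ws k \<omega>"
    using sieve_T_bounds[OF assms(1), of k] assms(1)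
    by (intro mult_left_le) (auto simp: regular_def intro: less_imp_le)
  then show ?case using step by (simp add: sieve_T_Suc)
qed auto

lemma prob_U_interval:
  assumes "1 \<le> i" "0 \<le> l" "l \<le> r" "r \<le> 1"
  shows "prob {\<omega> \<in> space M. l < U i \<omega> \<and> U i \<omega> \<le> r} = r - l"
proof -
  have "prob {\<omega> \<in> space M. l < U i \<omega> \<and> U i \<omega> \<le> r} = measure (distr M borel (U i)) {l<..r}"
    using U_measurable[OF assms(1)] by (subst measure_distr) (auto intro!: arg_cong[where f = prob])
  also have "\<dots> = measure lborel ({0..1} \<inter> {l<..r})"
    unfolding U_uniform[OF assms(1)] by simp
  also have "{0..1} \<inter> {l<..r} = {l<..r}" using assms by auto
  finally show ?thesis using assms by simp
qed

lemma prob_U_box: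
  assumes "finite J" "J \<subseteq> {1..}" and lr: "\<And>i. i \<in> J \<Longrightarrow> 0 \<le> l i \<and> l i \<le> r i \<and> r i \<le> 1"
  shows "prob {\<omega> \<in> space M. \<forall>i\<in>J. l i < U i \<omega> \<and> U i \<omega> \<le> r i} = (\<Prod>i\<in>J. r i - l i)"
proof (cases "J = {}")
  case True
  then show ?thesis by (simp add: prob_space)
next
  case False
  have "{\<omega> \<in> space M. \<forall>i\<in>J. l i < U i \<omega> \<and> U i \<omega> \<le> r i} = (\<Inter>i\<in>J. U i -` {l i<..r i} \<inter> space M)"
    using False by auto
  also have "prob \<dots> = (\<Prod>i\<in>J. prob (U i -` {l i<..r i} \<inter> space M))"
    using False assms by (intro indep_varsD[OF U_indep]) auto
  also have "\<dots> = (\<Prod>i\<in>J. r i - l i)"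
  proof (intro prod.cong refl)
    fix i assume "i \<in> J"
    then show "prob (U i -` {l i<..r i} \<inter> space M) = r i - l i"
      using prob_U_interval[of i "l i" "r i"] lr assms(2) by (auto simp: vimage_def Int_def conj_ac)
  qed
  finally show ?thesis .
qed

section \<open>Joint independence of factors and balls\<close>

text \<open>Factors and balls form one family over a sum type, so that any two disjoint mixed
  collections of them can be separated by a single independence statement.\<close>

definition WU :: "nat + nat \<Rightarrow> 'a \<Rightarrow> real" where
  "WU = case_sum Ws U"

lemma WU_simps [simp]: "WU (Inl k) = Ws k" "WU (Inr i) = U i"
  by (auto simp: WU_def)

text \<open>A finite index set splits into factor indices \<open>P\<close> and ball indices
  \<open>Q\<close>. Independence of the two sequences separates these parts, and independence within
  each sequence factors the rest.\<close>

lemma indep_WU: "indep_vars (\<lambda>_. borel) WU ({1..} <+> {1..})"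
  unfolding indep_vars_def2
proof (intro conjI ballI indep_setsI)
  fix j :: "nat + nat" assume "j \<in> {1..} <+> {1..}"
  then show *: "random_variable borel (WU j)"
    using Ws_measurable U_measurable by auto
  then show "{WU j -` A \<inter> space M |A. A \<in> sets borel} \<subseteq> events"
    by (auto intro: measurable_sets)
next
  fix A and J :: "(nat + nat) set"
  assume J: "J \<noteq> {}" "J \<subseteq> {1..} <+> {1..}" "finite J"
    and "\<forall>j\<in>J. A j \<in> {WU j -` A \<inter> space M |A. A \<in> sets borel}"
  then have "\<forall>j\<in>J. \<exists>B. B \<in> sets borel \<and> A j = WU j -` B \<inter> space M" by auto
  then obtain B where B: "\<And>j. j \<in> J \<Longrightarrow> B j \<in> sets borel" "\<And>j. j \<in> J \<Longrightarrow> A j = WU j -` B j \<inter> space M"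
    by metis
  define P where "P = Inl -` J"
  define Q where "Q = Inr -` J"
  have PQ: "J = Inl ` P \<union> Inr ` Q" "Inl ` P \<inter> Inr ` Q = {}" "P \<subseteq> {1..}" "Q \<subseteq> {1..}"
    using J(2) by (auto simp: P_def Q_def)
  have fin: "finite P" "finite Q"
    unfolding P_def Q_def using J(3) by (auto intro!: finite_vimageI)
  have BP: "B (Inl k) \<in> sets borel" if "k \<in> P" for k using that B(1) PQ by auto
  have BQ: "B (Inr k) \<in> sets borel" if "k \<in> Q" for k using that B(1) PQ by auto
  let ?S = "\<lambda>R c. {f \<in> space (PiM {1..} (\<lambda>_. borel)). \<forall>k\<in>R. f k \<in> B (c k)}"
  have S_sets: "?S R c \<in> sets (PiM {1..} (\<lambda>_. borel))"
    if "finite R" "R \<subseteq> {1..}" "\<And>k. k \<in> R \<Longrightarrow> B (c k) \<in> sets borel" for R and c :: "nat \<Rightarrow> nat + nat"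
  proof (intro sets.sets_Collect_finite_All that(1))
    fix k assume k: "k \<in> R"
    then have "(\<lambda>f. f k) -` B (c k) \<inter> space (PiM {1..} (\<lambda>_. borel)) \<in> sets (PiM {1..} (\<lambda>_. borel))"
      using that by (intro measurable_sets[OF measurable_component_singleton]) auto
    then show "{f \<in> space (PiM {1..} (\<lambda>_. borel)). f k \<in> B (c k)} \<in> sets (PiM {1..} (\<lambda>_. borel))"
      by (simp add: vimage_def Int_def conj_commute)
  qed
  have marg: "prob ((\<lambda>\<omega>. \<lambda>k\<in>{1..}. V k \<omega>) -` ?S R c \<inter> space M) = (\<Prod>k\<in>R. prob (V k -` B (c k) \<inter> space M))"
    if "indep_vars (\<lambda>_. borel) V {1..}" "finite R" "R \<subseteq> {1..}" "\<And>k. k \<in> R \<Longrightarrow> B (c k) \<in> sets borel"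
    for V :: "nat \<Rightarrow> 'a \<Rightarrow> real" and R and c :: "nat \<Rightarrow> nat + nat"
  proof (cases "R = {}")
    case True
    then have "(\<lambda>\<omega>. \<lambda>k\<in>{1..}. V k \<omega>) -` ?S R c \<inter> space M = space M"
      by (auto simp: space_PiM)
    then show ?thesis using True by (simp add: prob_space)
  next
    case False
    have "(\<lambda>\<omega>. \<lambda>k\<in>{1..}. V k \<omega>) -` ?S R c \<inter> space M = (\<Inter>k\<in>R. V k -` B (c k) \<inter> space M)"
      using False that(3) by (auto simp: space_PiM)
    then show ?thesis
      using indep_varsD[OF that(1) False that(2,3), of "\<lambda>k. B (c k)"] that(4) by simp
  qed
  have "(\<Inter>j\<in>J. A j) = {\<omega> \<in> space M. \<forall>j\<in>J. WU j \<omega> \<in> B j}"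
    using J(1) B(2) by auto
  also have "\<dots> = {\<omega> \<in> space M. (\<forall>k\<in>P. Ws k \<omega> \<in> B (Inl k)) \<and> (\<forall>k\<in>Q. U k \<omega> \<in> B (Inr k))}"
    unfolding PQ(1) ball_Un by simp
  also have "\<dots> = (\<lambda>\<omega>. (\<lambda>k\<in>{1..}. Ws k \<omega>, \<lambda>k\<in>{1..}. U k \<omega>)) -` (?S P Inl \<times> ?S Q Inr) \<inter> space M"
    using subsetD[OF PQ(3)] subsetD[OF PQ(4)] by (auto simp: space_PiM)
  finally have "prob (\<Inter>j\<in>J. A j)
      = (\<Prod>k\<in>P. prob (Ws k -` B (Inl k) \<inter> space M)) * (\<Prod>k\<in>Q. prob (U k -` B (Inr k) \<inter> space M))"
    using indep_varD[OF Ws_U_indep, of "?S P Inl" "?S Q Inr"] S_sets[OF fin(1) PQ(3) BP] S_sets[OF fin(2) PQ(4) BQ]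
      marg[OF Ws_indep fin(1) PQ(3) BP] marg[OF U_indep fin(2) PQ(4) BQ] by simp
  also have "\<dots> = (\<Prod>j\<in>J. prob (A j))"
    unfolding PQ(1) using fin PQ B(2)
    by (subst prod.union_disjoint) (auto simp: prod.reindex)
  finally show "prob (\<Inter>j\<in>J. A j) = (\<Prod>j\<in>J. prob (A j))" .
qed

abbreviation block :: "(nat + nat) set \<Rightarrow> 'a \<Rightarrow> nat + nat \<Rightarrow> real" where
  "block A \<omega> \<equiv> restrict (\<lambda>j. WU j \<omega>) A"

lemma block_fubini:
  fixes h :: "(nat + nat \<Rightarrow> real) \<Rightarrow> (nat + nat \<Rightarrow> real) \<Rightarrow> 'd::{banach, second_countable_topology}"
  assumes "A \<inter> B = {}" "A \<subseteq> {1..} <+> {1..}" "B \<subseteq> {1..} <+> {1..}"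
    and "case_prod h \<in> borel_measurable (PiM A (\<lambda>_. borel) \<Otimes>\<^sub>M PiM B (\<lambda>_. borel))"
    and "\<And>x y. norm (h x y) \<le> C"
  shows "expectation (\<lambda>\<omega>. h (block A \<omega>) (block B \<omega>))
    = expectation (\<lambda>\<omega>. expectation (\<lambda>\<omega>'. h (block A \<omega>) (block B \<omega>')))"
  by (rule indep_var_fubini[OF indep_var_restrict[OF indep_WU assms(1-3)] assms(4,5)])

text \<open>The product \<open>sieve_T\<close> as a function of the coordinates in a block, so that
  it can occur in functions of one block alone.\<close>

definition prod_T :: "nat \<Rightarrow> (nat + nat \<Rightarrow> real) \<Rightarrow> real" where
  "prod_T K d = (\<Prod>k=1..K. d (Inl k))"

lemma prod_T_measurable:
  "Inl ` {1..K} \<subseteq> A \<Longrightarrow> prod_T K \<in> borel_measurable (PiM A (\<lambda>_. borel))"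
  unfolding prod_T_def[abs_def]
  by (intro borel_measurable_prod measurable_component_singleton) auto

lemma prod_T_block: "Inl ` {1..K} \<subseteq> A \<Longrightarrow> prod_T K (block A \<omega>) = sieve_T Ws K \<omega>"
  unfolding prod_T_def sieve_T_def by (intro prod.cong) (simp_all add: subset_iff image_iff)

text \<open>Freezing the last factor leaves a product of \<open>K\<close> factors started from
  \<open>x * Ws (Suc K) \<omega>\<close>, to which the induction hypothesis applies.\<close>

lemma expectation_bump_sieve_T:
  "expectation (\<lambda>\<omega>. bump (x * sieve_T Ws K \<omega>)) = (step ^^ K) bump x"
proof (induction K arbitrary: x)
  case 0
  then show ?case by (simp add: sieve_T_def prob_space)
next
  case (Suc K)
  let ?A = "{Inl (Suc K)} :: (nat + nat) set" and ?B = "Inl ` {1..K} :: (nat + nat) set"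
  have [measurable]: "prod_T K \<in> borel_measurable (PiM ?B (\<lambda>_. borel))"
    by (rule prod_T_measurable) simp
  have [measurable]: "(\<lambda>a. a (Inl (Suc K))) \<in> borel_measurable (PiM ?A (\<lambda>_. borel :: real measure))"
    by (rule measurable_component_singleton) simp
  have "expectation (\<lambda>\<omega>. bump (x * sieve_T Ws (Suc K) \<omega>))
      = expectation (\<lambda>\<omega>. bump (x * block ?A \<omega> (Inl (Suc K)) * prod_T K (block ?B \<omega>)))"
    by (simp add: sieve_T_Suc prod_T_block mult_ac)
  also have "\<dots> = expectation (\<lambda>\<omega>. expectation (\<lambda>\<omega>'. bump (x * block ?A \<omega> (Inl (Suc K)) * prod_T K (block ?B \<omega>'))))"
  proof (rule block_fubini)
    show "norm (bump (x * a (Inl (Suc K)) * prod_T K b)) \<le> 1" for a b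
      using bump_bounds by simp
    show "(\<lambda>(a, b). bump (x * a (Inl (Suc K)) * prod_T K b))
        \<in> borel_measurable (PiM ?A (\<lambda>_. borel) \<Otimes>\<^sub>M PiM ?B (\<lambda>_. borel))"
      by measurable
  qed auto
  also have "\<dots> = expectation (\<lambda>\<omega>. (step ^^ K) bump (x * Ws (Suc K) \<omega>))"
    by (simp add: prod_T_block Suc)
  also have "\<dots> = (step ^^ Suc K) bump x"
    unfolding step_pow_Suc by (rule expectation_Ws) auto
  finally show ?case .
qed

text \<open>Given the factor \<open>w\<close>, each ball of \<open>J\<close> lands independently in
  an interval of length \<open>t * (\<psi> w - \<phi> w)\<close>. With \<open>t\<close> as the
  current level, the functions 0, 1 and the identity describe balls that are still present, stay
  beyond the next box, or fall into it.\<close>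

lemma prob_thinned_interval:
  assumes J: "finite J" "J \<subseteq> {1..}" and "1 \<le> k" and t: "0 \<le> t" "t \<le> 1"
    and [measurable]: "\<phi> \<in> borel_measurable borel" "\<psi> \<in> borel_measurable borel"
    and bnd: "\<And>w. 0 < w \<Longrightarrow> w < 1 \<Longrightarrow> 0 \<le> \<phi> w \<and> \<phi> w \<le> \<psi> w \<and> \<psi> w \<le> (1::real)"
  shows "prob {\<omega> \<in> space M. \<forall>i\<in>J. t * \<phi> (Ws k \<omega>) < U i \<omega> \<and> U i \<omega> \<le> t * \<psi> (Ws k \<omega>)}
    = t ^ card J * expectation (\<lambda>\<omega>. (\<psi> (W \<omega>) - \<phi> (W \<omega>)) ^ card J)"
proof -
  let ?A = "{Inl k} :: (nat + nat) set" and ?B = "Inr ` J :: (nat + nat) set"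
  let ?h = "\<lambda>a b. indicator {b. \<forall>i\<in>J. t * \<phi> (a (Inl k)) < b (Inr i) \<and> b (Inr i) \<le> t * \<psi> (a (Inl k))} b :: real"
  have [measurable]: "(\<lambda>a. a (Inl k)) \<in> borel_measurable (PiM ?A (\<lambda>_. borel :: real measure))"
    by (rule measurable_component_singleton) simp
  have [measurable]: "(\<lambda>a. a (Inr i)) \<in> borel_measurable (PiM ?B (\<lambda>_. borel :: real measure))" if "i \<in> J" for i
    using that by (intro measurable_component_singleton) simp
  have [measurable]: "random_variable borel (U i)" if "i \<in> J" for i
    using that J by (intro U_measurable) auto
  note [measurable] = Ws_measurable[OF \<open>1 \<le> k\<close>]
  have "prob {\<omega> \<in> space M. \<forall>i\<in>J. t * \<phi> (Ws k \<omega>) < U i \<omega> \<and> U i \<omega> \<le> t * \<psi> (Ws k \<omega>)}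
      = expectation (indicator {\<omega> \<in> space M. \<forall>i\<in>J. t * \<phi> (Ws k \<omega>) < U i \<omega> \<and> U i \<omega> \<le> t * \<psi> (Ws k \<omega>)})"
    using J(1) by simp
  also have "\<dots> = expectation (\<lambda>\<omega>. ?h (block ?A \<omega>) (block ?B \<omega>))"
    by (intro Bochner_Integration.integral_cong) (auto simp: indicator_def)
  also have "\<dots> = expectation (\<lambda>\<omega>. expectation (\<lambda>\<omega>'. ?h (block ?A \<omega>) (block ?B \<omega>')))"
  proof (rule block_fubini)
    show "case_prod ?h \<in> borel_measurable (PiM ?A (\<lambda>_. borel) \<Otimes>\<^sub>M PiM ?B (\<lambda>_. borel))"
      unfolding indicator_def mem_Collect_eq split_beta using J(1) by measurable
  qed (use J \<open>1 \<le> k\<close> in \<open>auto simp: indicator_def\<close>)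
  also have "\<dots> = expectation (\<lambda>\<omega>. t ^ card J * (\<psi> (Ws k \<omega>) - \<phi> (Ws k \<omega>)) ^ card J)"
  proof (rule integral_cong_AE)
    have inner: "expectation (\<lambda>\<omega>'. ?h (block ?A \<omega>) (block ?B \<omega>'))
        = prob {\<omega>' \<in> space M. \<forall>i\<in>J. t * \<phi> (Ws k \<omega>) < U i \<omega>' \<and> U i \<omega>' \<le> t * \<psi> (Ws k \<omega>)}" for \<omega>
    proof -
      have "expectation (\<lambda>\<omega>'. ?h (block ?A \<omega>) (block ?B \<omega>'))
        = expectation (indicator {\<omega>' \<in> space M. \<forall>i\<in>J. t * \<phi> (Ws k \<omega>) < U i \<omega>' \<and> U i \<omega>' \<le> t * \<psi> (Ws k \<omega>)})"
        by (intro Bochner_Integration.integral_cong) (auto simp: indicator_def)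
      then show ?thesis using J(1) by simp
    qed
    show "AE \<omega> in M. expectation (\<lambda>\<omega>'. ?h (block ?A \<omega>) (block ?B \<omega>'))
        = t ^ card J * (\<psi> (Ws k \<omega>) - \<phi> (Ws k \<omega>)) ^ card J"
      using AE_Ws[OF \<open>1 \<le> k\<close>]
    proof eventually_elim
      case (elim \<omega>)
      then have w: "0 \<le> \<phi> (Ws k \<omega>)" "\<phi> (Ws k \<omega>) \<le> \<psi> (Ws k \<omega>)" "\<psi> (Ws k \<omega>) \<le> 1"
        using bnd by auto
      have "t * \<psi> (Ws k \<omega>) \<le> 1" using w t by (intro mult_le_one) auto
      then show ?case
        unfolding inner using w t J
        by (subst prob_U_box) (auto simp: mult_left_mono power_mult_distrib[symmetric] right_diff_distrib)
    qed
    show "(\<lambda>\<omega>. expectation (\<lambda>\<omega>'. ?h (block ?A \<omega>) (block ?B \<omega>'))) \<in> borel_measurable M"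
      unfolding inner using J(1) by measurable
  qed measurable
  also have "\<dots> = t ^ card J * expectation (\<lambda>\<omega>. (\<psi> (W \<omega>) - \<phi> (W \<omega>)) ^ card J)"
    using expectation_Ws[OF \<open>1 \<le> k\<close>, of "\<lambda>w. t ^ card J * (\<psi> w - \<phi> w) ^ card J"] by simp
  finally show ?thesis .
qed

section \<open>The Markov chain of remaining balls\<close>

text \<open>The Markov property in disguise. \<open>G\<close> sees only the first \<open>K\<close>
  factors and the balls in \<open>N\<close>; integrating out the balls in \<open>J\<close> and the
  next factor gives \<open>sieve_T Ws K \<omega> ^ card J\<close> times a constant. The first
  expectation on the right is the same for all \<open>\<phi>\<close> and
  \<open>\<psi>\<close>.\<close>

lemma block_law:
  fixes G :: "(nat + nat \<Rightarrow> real) \<Rightarrow> complex"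
  assumes J: "finite J" "J \<subseteq> {1..}" and A: "A = {1..K} <+> N" "N \<subseteq> {1..}" "N \<inter> J = {}"
    and G: "G \<in> borel_measurable (PiM A (\<lambda>_. borel))" "\<And>d. norm (G d) \<le> 1"
    and [measurable]: "\<phi> \<in> borel_measurable borel" "\<psi> \<in> borel_measurable borel"
    and bnd: "\<And>w. 0 < w \<Longrightarrow> w < 1 \<Longrightarrow> 0 \<le> \<phi> w \<and> \<phi> w \<le> \<psi> w \<and> \<psi> w \<le> (1::real)"
  shows "expectation (\<lambda>\<omega>. if \<forall>i\<in>J. sieve_T Ws K \<omega> * \<phi> (Ws (Suc K) \<omega>) < U i \<omega>
        \<and> U i \<omega> \<le> sieve_T Ws K \<omega> * \<psi> (Ws (Suc K) \<omega>) then G (block A \<omega>) else 0)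
    = expectation (\<lambda>\<omega>. G (block A \<omega>) * complex_of_real (sieve_T Ws K \<omega> ^ card J))
      * complex_of_real (expectation (\<lambda>\<omega>. (\<psi> (W \<omega>) - \<phi> (W \<omega>)) ^ card J))"
proof -
  let ?B = "{Suc K} <+> J"
  let ?P = "\<lambda>t w u. \<forall>i\<in>J. t * \<phi> w < u i \<and> u i \<le> t * \<psi> w"
  let ?h = "\<lambda>a b. if ?P (prod_T K a) (b (Inl (Suc K))) (\<lambda>i. b (Inr i)) then G a else 0"
  note [measurable] = G(1)
  have sub: "Inl ` {1..K} \<subseteq> A" unfolding A by auto
  have [measurable]: "prod_T K \<in> borel_measurable (PiM A (\<lambda>_. borel))"
    by (rule prod_T_measurable[OF sub])
  have [measurable]: "(\<lambda>b. b (Inl (Suc K))) \<in> borel_measurable (PiM ?B (\<lambda>_. borel :: real measure))"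
    by (rule measurable_component_singleton) auto
  have [measurable]: "(\<lambda>b. b (Inr i)) \<in> borel_measurable (PiM ?B (\<lambda>_. borel :: real measure))" if "i \<in> J" for i
    using that by (intro measurable_component_singleton) auto
  have U_meas [measurable]: "random_variable borel (U i)" if "i \<in> J" for i
    using that J by (intro U_measurable) auto
  have [measurable]: "random_variable borel (Ws (Suc K))" by (rule Ws_measurable) simp
  have [measurable]: "block A \<in> M \<rightarrow>\<^sub>M PiM A (\<lambda>_. borel)"
    using A Ws_measurable U_measurable by (intro measurable_restrict) auto
  let ?m = "expectation (\<lambda>\<omega>. (\<psi> (W \<omega>) - \<phi> (W \<omega>)) ^ card J)"
  have "expectation (\<lambda>\<omega>. if ?P (sieve_T Ws K \<omega>) (Ws (Suc K) \<omega>) (\<lambda>i. U i \<omega>) then G (block A \<omega>) else 0)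
      = expectation (\<lambda>\<omega>. ?h (block A \<omega>) (block ?B \<omega>))"
    by (simp add: prod_T_block[OF sub])
  also have "\<dots> = expectation (\<lambda>\<omega>. expectation (\<lambda>\<omega>'. ?h (block A \<omega>) (block ?B \<omega>')))"
  proof (rule block_fubini)
    show "(\<lambda>(a, b). ?h a b) \<in> borel_measurable (PiM A (\<lambda>_. borel) \<Otimes>\<^sub>M PiM ?B (\<lambda>_. borel))"
      using J(1) by measurable
    show "A \<inter> ?B = {}" "A \<subseteq> {1..} <+> {1..}" "?B \<subseteq> {1..} <+> {1..}"
      using A J by auto
  qed (use G in auto)
  also have "\<dots> = expectation (\<lambda>\<omega>. G (block A \<omega>) * complex_of_real (sieve_T Ws K \<omega> ^ card J) * complex_of_real ?m)"
  proof (rule integral_cong_AE)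
    have inner: "expectation (\<lambda>\<omega>'. ?h (block A \<omega>) (block ?B \<omega>'))
        = G (block A \<omega>) * prob {\<omega>' \<in> space M. ?P (sieve_T Ws K \<omega>) (Ws (Suc K) \<omega>') (\<lambda>i. U i \<omega>')}" for \<omega>
    proof -
      let ?E = "{\<omega>' \<in> space M. ?P (sieve_T Ws K \<omega>) (Ws (Suc K) \<omega>') (\<lambda>i. U i \<omega>')}"
      have "?E \<in> events" using J(1) by measurable
      have "expectation (\<lambda>\<omega>'. ?h (block A \<omega>) (block ?B \<omega>'))
          = expectation (\<lambda>\<omega>'. G (block A \<omega>) * complex_of_real (indicator ?E \<omega>'))"
        by (intro Bochner_Integration.integral_cong) (auto simp: prod_T_block[OF sub] indicator_def)
      also have "\<dots> = G (block A \<omega>) * complex_of_real (expectation (indicator ?E))"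
        by (simp only: integral_mult_right_zero integral_complex_of_real)
      finally show ?thesis using \<open>?E \<in> events\<close> by simp
    qed
    show "AE \<omega> in M. expectation (\<lambda>\<omega>'. ?h (block A \<omega>) (block ?B \<omega>'))
        = G (block A \<omega>) * complex_of_real (sieve_T Ws K \<omega> ^ card J) * complex_of_real ?m"
      using AE_regular
    proof eventually_elim
      case (elim \<omega>)
      then show ?case
        unfolding inner using sieve_T_bounds[OF elim, of K] bnd J
        by (subst prob_thinned_interval) auto
    qed
    show "(\<lambda>\<omega>. expectation (\<lambda>\<omega>'. ?h (block A \<omega>) (block ?B \<omega>'))) \<in> borel_measurable M"
      unfolding inner using J(1) by measurable
  qed measurable
  finally show ?thesis by simp
qed

section \<open>States of the chain and their transitions\<close>

definition inner_balls :: "nat \<Rightarrow> nat \<Rightarrow> 'a \<Rightarrow> nat set" where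
  "inner_balls n K \<omega> = {i\<in>{1..n}. U i \<omega> \<le> sieve_T Ws K \<omega>}"

text \<open>\<open>s\<close> to the number of empty boxes among the first \<open>K\<close> that
  count for the occupancy range: box \<open>k\<close> counts if it takes no ball while some ball
  remains. Nonemptiness stops the count after the last ball.\<close>

definition empty_weight :: "complex \<Rightarrow> nat \<Rightarrow> nat \<Rightarrow> 'a \<Rightarrow> complex" where
  "empty_weight s n K \<omega> = (\<Prod>k=1..K. if inner_balls n k \<omega> = inner_balls n (k - 1) \<omega>
     \<and> inner_balls n k \<omega> \<noteq> {} then s else 1)"

lemma inner_balls_subset: "inner_balls n K \<omega> \<subseteq> {1..n}"
  by (auto simp: inner_balls_def)

lemma inner_balls_antimono: "regular \<omega> \<Longrightarrow> j \<le> k \<Longrightarrow> inner_balls n k \<omega> \<subseteq> inner_balls n j \<omega>"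
  using sieve_T_antimono by (fastforce simp: inner_balls_def)

lemma inner_balls_0: "regular \<omega> \<Longrightarrow> inner_balls n 0 \<omega> = {1..n}"
  by (auto simp: inner_balls_def sieve_T_def regular_def)

lemma inner_balls_measurable [measurable]: "Measurable.pred M (\<lambda>\<omega>. inner_balls n K \<omega> = J)"
proof -
  have [measurable]: "random_variable borel (U i)" if "i \<in> {1..n}" for i
    using that by (intro U_measurable) auto
  have "(\<lambda>\<omega>. inner_balls n K \<omega> = J)
      = (\<lambda>\<omega>. J \<subseteq> {1..n} \<and> (\<forall>i\<in>{1..n}. U i \<omega> \<le> sieve_T Ws K \<omega> \<longleftrightarrow> i \<in> J))"
    by (auto simp: inner_balls_def fun_eq_iff)
  also have "Measurable.pred M \<dots>" by measurable
  finally show ?thesis .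
qed

lemma inner_balls_eq_measurable [measurable]:
  "Measurable.pred M (\<lambda>\<omega>. inner_balls n K \<omega> = inner_balls n L \<omega>)"
proof -
  have "(\<lambda>\<omega>. inner_balls n K \<omega> = inner_balls n L \<omega>)
      = (\<lambda>\<omega>. \<exists>J\<in>Pow {1..n}. inner_balls n K \<omega> = J \<and> inner_balls n L \<omega> = J)"
    using inner_balls_subset by (auto simp: fun_eq_iff)
  also have "Measurable.pred M \<dots>" by measurable
  finally show ?thesis .
qed

lemma empty_weight_measurable [measurable]: "empty_weight s n K \<in> borel_measurable M"
  unfolding empty_weight_def[abs_def] by measurable

lemma norm_empty_weight: "norm s \<le> 1 \<Longrightarrow> norm (empty_weight s n K \<omega>) \<le> 1"
  unfolding empty_weight_def prod_norm[symmetric] by (intro prod_le_1) auto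

lemma empty_weight_1: "empty_weight 1 n K \<omega> = 1"
  by (simp add: empty_weight_def)

text \<open>\<open>empty_weight\<close> rewritten through the first \<open>K\<close> factors and the
  balls in \<open>N\<close> alone, where \<open>N\<close> stands for the balls already placed. The
  value 0 records that some ball of \<open>N\<close> is not yet placed, so the event is built into
  the weight.\<close>

definition outer_weight :: "complex \<Rightarrow> nat \<Rightarrow> nat set \<Rightarrow> (nat + nat \<Rightarrow> real) \<Rightarrow> complex" where
  "outer_weight s K N d = (if \<forall>i\<in>N. prod_T K d < d (Inr i)
     then \<Prod>k=1..K. (if \<forall>i\<in>N. \<not> (prod_T k d < d (Inr i) \<and> d (Inr i) \<le> prod_T (k - 1) d) then s else 1)
     else 0)"

lemma norm_outer_weight: "norm s \<le> 1 \<Longrightarrow> norm (outer_weight s K N d) \<le> 1"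
  unfolding outer_weight_def by (auto simp: prod_norm[symmetric] intro!: prod_le_1)

lemma outer_weight_measurable:
  assumes "finite N"
  shows "outer_weight s K N \<in> borel_measurable (PiM ({1..K} <+> N) (\<lambda>_. borel))"
proof -
  have [measurable]: "prod_T K \<in> borel_measurable (PiM ({1..K} <+> N) (\<lambda>_. borel))"
    by (rule prod_T_measurable) auto
  have [measurable]: "(\<lambda>b. b (Inr i)) \<in> borel_measurable (PiM ({1..K} <+> N) (\<lambda>_. borel :: real measure))"
    if "i \<in> N" for i
    using that by (intro measurable_component_singleton) auto
  have cond: "(\<lambda>d. if \<forall>i\<in>N. \<not> (f d < d (Inr i) \<and> d (Inr i) \<le> g d) then s else 1)
      \<in> borel_measurable (PiM ({1..K} <+> N) (\<lambda>_. borel))"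
    if fg: "f \<in> borel_measurable (PiM ({1..K} <+> N) (\<lambda>_. borel))"
      "g \<in> borel_measurable (PiM ({1..K} <+> N) (\<lambda>_. borel))" for f g :: "(nat + nat \<Rightarrow> real) \<Rightarrow> real"
  proof (intro measurable_If measurable_const sets.sets_Collect_finite_All assms)
    fix i assume "i \<in> N"
    then have i: "(\<lambda>d. d (Inr i)) \<in> borel_measurable (PiM ({1..K} <+> N) (\<lambda>_. borel :: real measure))"
      by (intro measurable_component_singleton) auto
    show "{d \<in> space (PiM ({1..K} <+> N) (\<lambda>_. borel)). \<not> (f d < d (Inr i) \<and> d (Inr i) \<le> g d)}
        \<in> sets (PiM ({1..K} <+> N) (\<lambda>_. borel))"
      by (intro sets.sets_Collect_neg sets.sets_Collect_conj borel_measurable_less borel_measurable_le fg i)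
  qed auto
  have "(\<lambda>d. if \<forall>i\<in>N. \<not> (prod_T k d < d (Inr i) \<and> d (Inr i) \<le> prod_T (k - 1) d) then s else 1)
      \<in> borel_measurable (PiM ({1..K} <+> N) (\<lambda>_. borel))" if "k \<in> {1..K}" for k
    using that by (intro cond prod_T_measurable) auto
  then have [measurable]: "(\<lambda>d. \<Prod>k=1..K. if \<forall>i\<in>N. \<not> (prod_T k d < d (Inr i) \<and> d (Inr i) \<le> prod_T (k - 1) d)
      then s else 1) \<in> borel_measurable (PiM ({1..K} <+> N) (\<lambda>_. borel))"
    by (intro borel_measurable_prod)
  show ?thesis
    unfolding outer_weight_def[abs_def] using assms by measurable
qed

lemma outer_weight_block:
  "outer_weight s K N (block ({1..K} <+> N) \<omega>) = (if \<forall>i\<in>N. sieve_T Ws K \<omega> < U i \<omega>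
     then \<Prod>k=1..K. (if \<forall>i\<in>N. \<not> (sieve_T Ws k \<omega> < U i \<omega> \<and> U i \<omega> \<le> sieve_T Ws (k - 1) \<omega>) then s else 1)
     else 0)"
proof -
  have T: "prod_T k (block ({1..K} <+> N) \<omega>) = sieve_T Ws k \<omega>" if "k \<le> K" for k
    using that by (intro prod_T_block) auto
  have "(\<Prod>k=1..K. (if \<forall>i\<in>N. \<not> (prod_T k (block ({1..K} <+> N) \<omega>) < U i \<omega>
        \<and> U i \<omega> \<le> prod_T (k - 1) (block ({1..K} <+> N) \<omega>)) then s else 1))
      = (\<Prod>k=1..K. (if \<forall>i\<in>N. \<not> (sieve_T Ws k \<omega> < U i \<omega> \<and> U i \<omega> \<le> sieve_T Ws (k - 1) \<omega>) then s else 1))"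
  proof (intro prod.cong refl)
    fix k assume "k \<in> {1..K}"
    then have "prod_T k (block ({1..K} <+> N) \<omega>) = sieve_T Ws k \<omega>"
      "prod_T (k - 1) (block ({1..K} <+> N) \<omega>) = sieve_T Ws (k - 1) \<omega>"
      by (intro T; auto)+
    then show "(if \<forall>i\<in>N. \<not> (prod_T k (block ({1..K} <+> N) \<omega>) < U i \<omega>
        \<and> U i \<omega> \<le> prod_T (k - 1) (block ({1..K} <+> N) \<omega>)) then s else 1)
      = (if \<forall>i\<in>N. \<not> (sieve_T Ws k \<omega> < U i \<omega> \<and> U i \<omega> \<le> sieve_T Ws (k - 1) \<omega>) then s else 1)"
      by (simp only:)
  qed
  moreover have "block ({1..K} <+> N) \<omega> (Inr i) = U i \<omega>" if "i \<in> N" for i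
    using that by auto
  ultimately show ?thesis
    unfolding outer_weight_def by (simp only: T order.refl cong: ball_cong)
qed

lemma inner_balls_eq_iff:
  assumes "J \<subseteq> {1..n}"
  shows "inner_balls n K \<omega> = J \<longleftrightarrow>
    (\<forall>i\<in>{1..n} - J. sieve_T Ws K \<omega> < U i \<omega>) \<and> (\<forall>i\<in>J. U i \<omega> \<le> sieve_T Ws K \<omega>)"
  using assms by (auto simp: inner_balls_def not_le[symmetric])

text \<open>As long as some balls remain, the boxes filled so far are determined by the balls outside \<open>J\<close>.\<close>

lemma empty_weight_eq_outer_weight:
  assumes reg: "regular \<omega>" and J: "J \<subseteq> {1..n}" "J \<noteq> {}" and eq: "inner_balls n K \<omega> = J"
  shows "empty_weight s n K \<omega> = outer_weight s K ({1..n} - J) (block ({1..K} <+> ({1..n} - J)) \<omega>)"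
proof -
  have *: "(inner_balls n k \<omega> = inner_balls n (k - 1) \<omega> \<and> inner_balls n k \<omega> \<noteq> {}) \<longleftrightarrow>
      (\<forall>i\<in>{1..n} - J. \<not> (sieve_T Ws k \<omega> < U i \<omega> \<and> U i \<omega> \<le> sieve_T Ws (k - 1) \<omega>))"
    if k: "k \<in> {1..K}" for k
  proof -
    have sub: "J \<subseteq> inner_balls n k \<omega>" "inner_balls n k \<omega> \<subseteq> inner_balls n (k - 1) \<omega>"
      using inner_balls_antimono[OF reg] k eq by auto
    then have "inner_balls n k \<omega> = inner_balls n (k - 1) \<omega> \<and> inner_balls n k \<omega> \<noteq> {} \<longleftrightarrow>
        (\<forall>i\<in>{1..n}. \<not> (i \<notin> inner_balls n k \<omega> \<and> i \<in> inner_balls n (k - 1) \<omega>))"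
      using J inner_balls_subset by blast
    also have "\<dots> \<longleftrightarrow> (\<forall>i\<in>{1..n} - J. \<not> (i \<notin> inner_balls n k \<omega> \<and> i \<in> inner_balls n (k - 1) \<omega>))"
      using sub by blast
    also have "\<dots> \<longleftrightarrow> (\<forall>i\<in>{1..n} - J. \<not> (sieve_T Ws k \<omega> < U i \<omega> \<and> U i \<omega> \<le> sieve_T Ws (k - 1) \<omega>))"
      by (auto simp: inner_balls_def not_le)
    finally show ?thesis .
  qed
  have "\<forall>i\<in>{1..n} - J. sieve_T Ws K \<omega> < U i \<omega>"
    using eq inner_balls_eq_iff[OF J(1)] by blast
  then show ?thesis
    unfolding outer_weight_block empty_weight_def by (simp only: if_P) (intro prod.cong refl, simp only: *)
qed

text \<open>Being in \<open>J\<close>, staying there and vanishing from there are, up to null sets,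
  events placing each ball of \<open>J\<close> in \<open>(0, T]\<close>, \<open>(0, T * w]\<close>
  and \<open>(T * w, T]\<close>, with \<open>T\<close> the current level and \<open>w\<close> the
  next factor. \<open>block_law\<close> gives all three the same first expectation, so the
  transition probabilities depend on \<open>card J\<close> only.\<close>

lemma transition:
  assumes s: "norm s \<le> 1" and J: "J \<subseteq> {1..n}" "J \<noteq> {}"
  shows "expectation (\<lambda>\<omega>. if inner_balls n K \<omega> = J \<and> inner_balls n (Suc K) \<omega> = J then empty_weight s n K \<omega> else 0)
      = expectation (\<lambda>\<omega>. if inner_balls n K \<omega> = J then empty_weight s n K \<omega> else 0)
        * complex_of_real (expectation (\<lambda>\<omega>. W \<omega> ^ card J))" (is ?stay)
    and "expectation (\<lambda>\<omega>. if inner_balls n K \<omega> = J \<and> inner_balls n (Suc K) \<omega> = {} then empty_weight s n K \<omega> else 0)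
      = expectation (\<lambda>\<omega>. if inner_balls n K \<omega> = J then empty_weight s n K \<omega> else 0)
        * complex_of_real (expectation (\<lambda>\<omega>. (1 - W \<omega>) ^ card J))" (is ?vanish)
proof -
  define N where "N = {1..n} - J"
  define G where "G \<omega> = outer_weight s K N (block ({1..K} <+> N) \<omega>)" for \<omega>
  let ?T = "sieve_T Ws K" and ?w = "Ws (Suc K)"
  have fin: "finite J" "finite N" using J by (auto simp: N_def intro: finite_subset)
  have [measurable]: "random_variable borel (U i)" if "i \<in> J" for i
    using that J by (intro U_measurable) auto
  have [measurable]: "random_variable borel ?w" by (rule Ws_measurable) simp
  have [measurable]: "block ({1..K} <+> N) \<in> M \<rightarrow>\<^sub>M PiM ({1..K} <+> N) (\<lambda>_. borel)"
    using Ws_measurable U_measurable by (intro measurable_restrict) (auto simp: N_def)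
  have [measurable]: "G \<in> borel_measurable M"
    unfolding G_def[abs_def] using outer_weight_measurable[OF fin(2), of s K] by measurable
  have G_eq: "empty_weight s n K \<omega> = G \<omega>" if "regular \<omega>" "inner_balls n K \<omega> = J" for \<omega>
    unfolding G_def N_def by (rule empty_weight_eq_outer_weight[OF that(1) J that(2)])
  \<comment> \<open>Since \<open>G\<close> vanishes unless all balls outside \<open>J\<close> are
    placed, the events below need to constrain only the balls in \<open>J\<close>.\<close>
  have G_0: "G \<omega> = 0" if "regular \<omega>" "inner_balls n K \<omega> \<noteq> J" "\<forall>i\<in>J. U i \<omega> \<le> ?T \<omega>" for \<omega>
    using that inner_balls_eq_iff[OF J(1)] unfolding G_def outer_weight_block N_def by auto
  have law: "expectation (\<lambda>\<omega>. if \<forall>i\<in>J. ?T \<omega> * \<phi> (?w \<omega>) < U i \<omega> \<and> U i \<omega> \<le> ?T \<omega> * \<psi> (?w \<omega>) then G \<omega> else 0)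
    = expectation (\<lambda>\<omega>. G \<omega> * complex_of_real (?T \<omega> ^ card J))
      * complex_of_real (expectation (\<lambda>\<omega>. (\<psi> (W \<omega>) - \<phi> (W \<omega>)) ^ card J))"
    if "\<phi> \<in> borel_measurable borel" "\<psi> \<in> borel_measurable borel"
      "\<And>w. 0 < w \<Longrightarrow> w < 1 \<Longrightarrow> 0 \<le> \<phi> w \<and> \<phi> w \<le> \<psi> w \<and> \<psi> w \<le> (1::real)" for \<phi> \<psi> :: "real \<Rightarrow> real"
    unfolding G_def
    using fin J that outer_weight_measurable[OF fin(2), of s K] norm_outer_weight[OF s, of K N]
    by (intro block_law[where N = N]) (auto simp: N_def)
  have visit: "expectation (\<lambda>\<omega>. if inner_balls n K \<omega> = J then empty_weight s n K \<omega> else 0)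
      = expectation (\<lambda>\<omega>. G \<omega> * complex_of_real (?T \<omega> ^ card J))"
  proof -
    have "expectation (\<lambda>\<omega>. if inner_balls n K \<omega> = J then empty_weight s n K \<omega> else 0)
      = expectation (\<lambda>\<omega>. if \<forall>i\<in>J. ?T \<omega> * 0 < U i \<omega> \<and> U i \<omega> \<le> ?T \<omega> * 1 then G \<omega> else 0)"
    proof (rule integral_cong_AE)
      show "AE \<omega> in M. (if inner_balls n K \<omega> = J then empty_weight s n K \<omega> else 0)
          = (if \<forall>i\<in>J. ?T \<omega> * 0 < U i \<omega> \<and> U i \<omega> \<le> ?T \<omega> * 1 then G \<omega> else 0)"
        using AE_regular
      proof eventually_elim
        case (elim \<omega>)
        have "0 < U i \<omega>" if "i \<in> J" for i using that J elim by (auto simp: regular_def)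
        then show ?case
          using G_eq[OF elim] G_0[OF elim] inner_balls_eq_iff[OF J(1), of K \<omega>] by auto
      qed
    qed (use fin in measurable)
    then show ?thesis using law[of "\<lambda>_. 0" "\<lambda>_. 1"] by (simp add: prob_space)
  qed
  have "expectation (\<lambda>\<omega>. if inner_balls n K \<omega> = J \<and> inner_balls n (Suc K) \<omega> = J then empty_weight s n K \<omega> else 0)
      = expectation (\<lambda>\<omega>. if \<forall>i\<in>J. ?T \<omega> * 0 < U i \<omega> \<and> U i \<omega> \<le> ?T \<omega> * ?w \<omega> then G \<omega> else 0)"
  proof (rule integral_cong_AE)
    show "AE \<omega> in M. (if inner_balls n K \<omega> = J \<and> inner_balls n (Suc K) \<omega> = J then empty_weight s n K \<omega> else 0)
        = (if \<forall>i\<in>J. ?T \<omega> * 0 < U i \<omega> \<and> U i \<omega> \<le> ?T \<omega> * ?w \<omega> then G \<omega> else 0)"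
      using AE_regular
    proof eventually_elim
      case (elim \<omega>)
      have pos: "0 < U i \<omega>" if "i \<in> J" for i using that J elim by (auto simp: regular_def)
      have le: "?T \<omega> * ?w \<omega> \<le> ?T \<omega>" using sieve_T_antimono[OF elim, of K "Suc K"] by (simp add: sieve_T_Suc)
      show ?case
      proof (cases "\<forall>i\<in>J. U i \<omega> \<le> ?T \<omega> * ?w \<omega>")
        case True
        then have "\<forall>i\<in>J. U i \<omega> \<le> ?T \<omega>" using le by auto
        moreover have "inner_balls n (Suc K) \<omega> = J" if "inner_balls n K \<omega> = J"
          using that True inner_balls_antimono[OF elim, of K "Suc K" n]
          unfolding inner_balls_eq_iff[OF J(1)] by (auto simp: sieve_T_Suc intro: le_less_trans[OF le])
        ultimately show ?thesis using True pos G_eq[OF elim] G_0[OF elim] by auto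
      next
        case False
        then have "inner_balls n (Suc K) \<omega> \<noteq> J"
          unfolding inner_balls_eq_iff[OF J(1)] by (auto simp: sieve_T_Suc)
        then show ?thesis using False by auto
      qed
    qed
  qed (use fin in measurable)
  also have "\<dots> = expectation (\<lambda>\<omega>. G \<omega> * complex_of_real (?T \<omega> ^ card J))
      * complex_of_real (expectation (\<lambda>\<omega>. W \<omega> ^ card J))"
    by (rule trans[OF law[of "\<lambda>_. 0" "\<lambda>w. w"]]) simp_all
  finally show ?stay unfolding visit .
  have "expectation (\<lambda>\<omega>. if inner_balls n K \<omega> = J \<and> inner_balls n (Suc K) \<omega> = {} then empty_weight s n K \<omega> else 0)
      = expectation (\<lambda>\<omega>. if \<forall>i\<in>J. ?T \<omega> * ?w \<omega> < U i \<omega> \<and> U i \<omega> \<le> ?T \<omega> * 1 then G \<omega> else 0)"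
  proof (rule integral_cong_AE)
    show "AE \<omega> in M. (if inner_balls n K \<omega> = J \<and> inner_balls n (Suc K) \<omega> = {} then empty_weight s n K \<omega> else 0)
        = (if \<forall>i\<in>J. ?T \<omega> * ?w \<omega> < U i \<omega> \<and> U i \<omega> \<le> ?T \<omega> * 1 then G \<omega> else 0)"
      using AE_regular
    proof eventually_elim
      case (elim \<omega>)
      have "inner_balls n (Suc K) \<omega> = {} \<longleftrightarrow> (\<forall>i\<in>J. ?T \<omega> * ?w \<omega> < U i \<omega>)" if "inner_balls n K \<omega> = J"
        using that inner_balls_antimono[OF elim, of K "Suc K" n] J
        by (auto simp: inner_balls_def sieve_T_Suc not_le[symmetric])
      then show ?case
        using G_eq[OF elim] G_0[OF elim] inner_balls_eq_iff[OF J(1), of K \<omega>] by auto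
    qed
  qed (use fin in measurable)
  also have "\<dots> = expectation (\<lambda>\<omega>. G \<omega> * complex_of_real (?T \<omega> ^ card J))
      * complex_of_real (expectation (\<lambda>\<omega>. (1 - W \<omega>) ^ card J))"
    by (rule trans[OF law[of "\<lambda>w. w" "\<lambda>_. 1"]]) simp_all
  finally show ?vanish unfolding visit .
qed

end

section \<open>Expected visits to small states and absorption\<close>

lemma power_le_fact_mult_exp:
  fixes x :: real
  assumes "0 \<le> x" shows "x ^ k \<le> fact k * exp x"
proof -
  have "(\<Sum>n\<in>{k}. x ^ n /\<^sub>R fact n) \<le> exp x"
    unfolding exp_def using assms by (intro sum_le_suminf summable_exp_generic) auto
  then show ?thesis by (simp add: field_simps)
qed

context bernoulli_sieve begin

text \<open>Comparison with a Poisson weight at \<open>x = n * t\<close>: by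
  \<open>1 - t \<le> exp (- t)\<close> and \<open>n choose m \<le> n ^ m\<close>, the left side is
  at most \<open>exp m * x ^ m * exp (- x)\<close>. The factorial bounds on powers then give a bound
  of order \<open>1 / x\<close> from the exponent \<open>m + 1\<close> and one of order
  \<open>x\<close> from \<open>m - 1\<close>; the latter uses \<open>m \<ge> 1\<close>.\<close>

lemma binomial_weight_le_bump:
  assumes "1 \<le> m" "m \<le> n" "0 < t" "t \<le> 1"
  shows "real (n choose m) * (t ^ m * (1 - t) ^ (n - m)) \<le> exp (real m) * fact (m + 1) * bump (real n * t)"
proof -
  let ?x = "real n * t"
  have "0 < ?x" using assms by simp
  have "1 - t \<le> exp (- t)" using exp_ge_add_one_self[of "- t"] by simp
  then have "(1 - t) ^ (n - m) \<le> exp (- t) ^ (n - m)" using assms by (intro power_mono) auto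
  also have "\<dots> = exp (real m * t - ?x)"
    using assms by (simp add: exp_of_nat_mult[symmetric] of_nat_diff algebra_simps)
  also have "\<dots> \<le> exp (real m) * exp (- ?x)"
    using assms unfolding exp_add[symmetric] by (auto intro: mult_left_le)
  finally have 1: "(1 - t) ^ (n - m) \<le> exp (real m) * exp (- ?x)" .
  have "real (n choose m) * t ^ m \<le> real n ^ m * t ^ m"
    using binomial_le_pow[OF assms(2)] assms
    by (intro mult_right_mono) (auto simp flip: of_nat_power)
  then have 2: "real (n choose m) * t ^ m \<le> ?x ^ m" by (simp add: power_mult_distrib)
  have 3: "?x ^ m * exp (- ?x) \<le> fact (m + 1) * bump ?x"
  proof -
    have "?x ^ (m + 1) * exp (- ?x) \<le> fact (m + 1)"
      using power_le_fact_mult_exp[of ?x "m + 1"] \<open>0 < ?x\<close> by (simp add: exp_minus field_simps)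
    then have "?x ^ m * exp (- ?x) \<le> fact (m + 1) * (1 / ?x)"
      using \<open>0 < ?x\<close> by (simp add: field_simps)
    moreover have "?x ^ m * exp (- ?x) \<le> fact (m + 1) * ?x"
    proof -
      have "?x ^ (m - 1) * exp (- ?x) \<le> fact (m - 1)"
        using power_le_fact_mult_exp[of ?x "m - 1"] \<open>0 < ?x\<close> by (simp add: exp_minus field_simps)
      also have "\<dots> \<le> fact (m + 1)" by (intro fact_mono) auto
      finally have "?x * (?x ^ (m - 1) * exp (- ?x)) \<le> ?x * fact (m + 1)"
        using \<open>0 < ?x\<close> by (intro mult_left_mono) auto
      moreover have "?x * (?x ^ (m - 1) * exp (- ?x)) = ?x ^ m * exp (- ?x)"
        using assms(1) by (cases m) auto
      ultimately show ?thesis by (simp only: mult.commute[of ?x])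
    qed
    ultimately show ?thesis using \<open>0 < ?x\<close> by (auto simp: bump_def min_def)
  qed
  have "real (n choose m) * (t ^ m * (1 - t) ^ (n - m))
      = (real (n choose m) * t ^ m) * (1 - t) ^ (n - m)" by simp
  also have "\<dots> \<le> ?x ^ m * (exp (real m) * exp (- ?x))"
    using 1 2 assms by (intro mult_mono) auto
  also have "\<dots> = exp (real m) * (?x ^ m * exp (- ?x))" by simp
  also have "\<dots> \<le> exp (real m) * (fact (m + 1) * bump ?x)"
    by (intro mult_left_mono 3) auto
  finally show ?thesis by (simp add: mult_ac)
qed

text \<open>Given the factors, the balls in \<open>J\<close> must fall in \<open>(0, t]\<close> and
  the others in \<open>(t, 1]\<close>, where \<open>t\<close> is the level reached. Almost surely
  this is the whole condition, as the balls lie in \<open>(0, 1]\<close>.\<close>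

lemma prob_inner_balls:
  assumes "J \<subseteq> {1..n}"
  shows "prob {\<omega> \<in> space M. inner_balls n K \<omega> = J}
    = expectation (\<lambda>\<omega>. sieve_T Ws K \<omega> ^ card J * (1 - sieve_T Ws K \<omega>) ^ (n - card J))"
proof -
  let ?A = "Inl ` {1..K} :: (nat + nat) set" and ?B = "Inr ` {1..n} :: (nat + nat) set"
  let ?P = "\<lambda>t u. \<forall>i\<in>{1..n}. u i \<le> t \<longleftrightarrow> i \<in> J"
  let ?h = "\<lambda>a b. if ?P (prod_T K a) (\<lambda>i. b (Inr i)) then 1 else 0 :: real"
  have fin: "finite J" using assms by (rule finite_subset) simp
  have [measurable]: "prod_T K \<in> borel_measurable (PiM ?A (\<lambda>_. borel))"
    by (rule prod_T_measurable) simp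
  have [measurable]: "(\<lambda>b. b (Inr i)) \<in> borel_measurable (PiM ?B (\<lambda>_. borel :: real measure))" if "i \<in> {1..n}" for i
    using that by (intro measurable_component_singleton) auto
  have U_meas [measurable]: "random_variable borel (U i)" if "i \<in> {1..n}" for i
    using that by (intro U_measurable) auto
  have "prob {\<omega> \<in> space M. inner_balls n K \<omega> = J}
      = expectation (indicator {\<omega> \<in> space M. inner_balls n K \<omega> = J})"
    by simp
  also have "\<dots> = expectation (\<lambda>\<omega>. ?h (block ?A \<omega>) (block ?B \<omega>))"
    using assms by (intro Bochner_Integration.integral_cong) (auto simp: indicator_def prod_T_block inner_balls_def)
  also have "\<dots> = expectation (\<lambda>\<omega>. expectation (\<lambda>\<omega>'. ?h (block ?A \<omega>) (block ?B \<omega>')))"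
  proof (rule block_fubini)
    show "(\<lambda>(a, b). ?h a b) \<in> borel_measurable (PiM ?A (\<lambda>_. borel) \<Otimes>\<^sub>M PiM ?B (\<lambda>_. borel))"
      by measurable
  qed auto
  also have "\<dots> = expectation (\<lambda>\<omega>. sieve_T Ws K \<omega> ^ card J * (1 - sieve_T Ws K \<omega>) ^ (n - card J))"
  proof (rule integral_cong_AE)
    have inner: "expectation (\<lambda>\<omega>'. ?h (block ?A \<omega>) (block ?B \<omega>'))
        = prob {\<omega>' \<in> space M. ?P (sieve_T Ws K \<omega>) (\<lambda>i. U i \<omega>')}" for \<omega>
    proof -
      let ?E = "{\<omega>' \<in> space M. ?P (sieve_T Ws K \<omega>) (\<lambda>i. U i \<omega>')}"
      have "?E \<in> events" by measurable
      have "expectation (\<lambda>\<omega>'. ?h (block ?A \<omega>) (block ?B \<omega>')) = expectation (indicator ?E)"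
        by (intro Bochner_Integration.integral_cong) (auto simp: prod_T_block indicator_def)
      then show ?thesis using \<open>?E \<in> events\<close> by simp
    qed
    show "AE \<omega> in M. expectation (\<lambda>\<omega>'. ?h (block ?A \<omega>) (block ?B \<omega>'))
        = sieve_T Ws K \<omega> ^ card J * (1 - sieve_T Ws K \<omega>) ^ (n - card J)"
      using AE_regular
    proof eventually_elim
      case (elim \<omega>)
      define t where "t = sieve_T Ws K \<omega>"
      have t: "0 \<le> t" "t \<le> 1" using sieve_T_bounds[OF elim] by (auto simp: t_def less_imp_le)
      let ?l = "\<lambda>i. if i \<in> J then 0 else t" and ?r = "\<lambda>i. if i \<in> J then t else 1"
      have "prob {\<omega>' \<in> space M. ?P t (\<lambda>i. U i \<omega>')}
          = prob {\<omega>' \<in> space M. \<forall>i\<in>{1..n}. ?l i < U i \<omega>' \<and> U i \<omega>' \<le> ?r i}"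
      proof (rule finite_measure_eq_AE)
        show "AE \<omega>' in M. \<omega>' \<in> {\<omega>' \<in> space M. ?P t (\<lambda>i. U i \<omega>')}
            \<longleftrightarrow> \<omega>' \<in> {\<omega>' \<in> space M. \<forall>i\<in>{1..n}. ?l i < U i \<omega>' \<and> U i \<omega>' \<le> ?r i}"
          using AE_regular
        proof eventually_elim
          case (elim \<omega>')
          then have "0 < U i \<omega>'" "U i \<omega>' \<le> 1" if "i \<in> {1..n}" for i
            using that by (auto simp: regular_def)
          then have "(U i \<omega>' \<le> t \<longleftrightarrow> i \<in> J) \<longleftrightarrow> ?l i < U i \<omega>' \<and> U i \<omega>' \<le> ?r i" if "i \<in> {1..n}" for i
            using that by (auto simp: not_le)
          then show ?case by auto
        qed
        show "{\<omega>' \<in> space M. \<forall>i\<in>{1..n}. ?l i < U i \<omega>' \<and> U i \<omega>' \<le> ?r i} \<in> events"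
          by measurable
      qed measurable
      also have "\<dots> = (\<Prod>i\<in>{1..n}. ?r i - ?l i)"
        using t by (intro prob_U_box) auto
      also have "\<dots> = (\<Prod>i\<in>{1..n}. if i \<in> J then t else 1 - t)"
        by (intro prod.cong) auto
      also have "\<dots> = t ^ card J * (1 - t) ^ (n - card J)"
        using assms fin by (subst prod.If_cases) (auto simp: Int_absorb1 Diff_eq[symmetric] card_Diff_subset)
      finally show ?case unfolding inner t_def .
    qed
    show "(\<lambda>\<omega>. expectation (\<lambda>\<omega>'. ?h (block ?A \<omega>) (block ?B \<omega>'))) \<in> borel_measurable M"
      unfolding inner by measurable
  qed measurable
  finally show ?thesis .
qed

text \<open>The \<open>n choose m\<close> sets of size \<open>m\<close> have equal probability, so
  the sum is an averaged binomial weight. Summed over \<open>K\<close>, this bounds the expected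
  number of visits to states of size \<open>m\<close> by a multiple of
  \<open>potential bump (real n)\<close>.\<close>

lemma sum_prob_inner_balls_le:
  assumes "1 \<le> m"
  shows "(\<Sum>J | J \<subseteq> {1..n} \<and> card J = m. prob {\<omega> \<in> space M. inner_balls n K \<omega> = J})
    \<le> exp (real m) * fact (m + 1) * (step ^^ K) bump (real n)"
proof (cases "m \<le> n")
  case False
  have "{J. J \<subseteq> {1..n} \<and> card J = m} = {}"
    using False card_mono[of "{1..n}"] by fastforce
  moreover have "0 \<le> (step ^^ K) bump (real n)"
    using step_pow_bounds[OF bump_measurable bump_bounds(1,2)] by blast
  ultimately show ?thesis by (simp only: sum.empty) simp
next
  case True
  let ?f = "\<lambda>\<omega>. sieve_T Ws K \<omega> ^ m * (1 - sieve_T Ws K \<omega>) ^ (n - m)"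
  have "(\<Sum>J | J \<subseteq> {1..n} \<and> card J = m. prob {\<omega> \<in> space M. inner_balls n K \<omega> = J})
      = (\<Sum>J | J \<subseteq> {1..n} \<and> card J = m. expectation ?f)"
    by (intro sum.cong refl) (auto simp: prob_inner_balls)
  also have "\<dots> = expectation (\<lambda>\<omega>. real (n choose m) * ?f \<omega>)"
    using n_subsets[of "{1..n}" m] by simp
  also have "\<dots> \<le> expectation (\<lambda>\<omega>. exp (real m) * fact (m + 1) * bump (real n * sieve_T Ws K \<omega>))"
  proof (rule integral_mono_AE)
    have "AE \<omega> in M. 0 < sieve_T Ws K \<omega> \<and> sieve_T Ws K \<omega> \<le> 1"
      using AE_regular by eventually_elim (rule sieve_T_bounds)
    then show "AE \<omega> in M. real (n choose m) * ?f \<omega>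
        \<le> exp (real m) * fact (m + 1) * bump (real n * sieve_T Ws K \<omega>)"
      by eventually_elim (use binomial_weight_le_bump[OF assms True] in auto)
    have "AE \<omega> in M. norm (?f \<omega>) \<le> 1"
      using \<open>AE \<omega> in M. 0 < sieve_T Ws K \<omega> \<and> sieve_T Ws K \<omega> \<le> 1\<close>
      by eventually_elim (auto simp: abs_mult power_le_one intro!: mult_le_one)
    then show "integrable M (\<lambda>\<omega>. real (n choose m) * ?f \<omega>)"
      by (intro integrable_mult_right integrable_const_bound[of _ 1]) auto
    show "integrable M (\<lambda>\<omega>. exp (real m) * fact (m + 1) * bump (real n * sieve_T Ws K \<omega>))"
      using bump_bounds by (intro integrable_mult_right integrable_const_bound[of _ 1]) auto
  qed
  also have "\<dots> = exp (real m) * fact (m + 1) * (step ^^ K) bump (real n)"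
    by (simp add: expectation_bump_sieve_T)
  finally show ?thesis .
qed

text \<open>The case \<open>s = 1\<close> of \<open>transition\<close>, where the complex weight is
  constantly 1.\<close>

lemma prob_vanish:
  assumes "J \<subseteq> {1..n}" "J \<noteq> {}"
  shows "prob {\<omega> \<in> space M. inner_balls n K \<omega> = J \<and> inner_balls n (Suc K) \<omega> = {}}
    = prob {\<omega> \<in> space M. inner_balls n K \<omega> = J} * expectation (\<lambda>\<omega>. (1 - W \<omega>) ^ card J)"
proof -
  have ind: "expectation (\<lambda>\<omega>. if P \<omega> then 1 else 0 :: complex) = complex_of_real (prob {\<omega> \<in> space M. P \<omega>})"
    if [measurable]: "Measurable.pred M P" for P
  proof -
    have "expectation (\<lambda>\<omega>. if P \<omega> then 1 else 0 :: complex)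
        = expectation (\<lambda>\<omega>. complex_of_real (indicator {\<omega> \<in> space M. P \<omega>} \<omega>))"
      by (intro Bochner_Integration.integral_cong) (auto simp: indicator_def)
    also have "\<dots> = complex_of_real (expectation (indicator {\<omega> \<in> space M. P \<omega>}))"
      by (rule integral_complex_of_real)
    also have "expectation (indicator {\<omega> \<in> space M. P \<omega>}) = prob {\<omega> \<in> space M. P \<omega>}"
      by simp
    finally show ?thesis .
  qed
  have m: "Measurable.pred M (\<lambda>\<omega>. inner_balls n K \<omega> = J)"
    "Measurable.pred M (\<lambda>\<omega>. inner_balls n K \<omega> = J \<and> inner_balls n (Suc K) \<omega> = {})"
    by measurable
  have "complex_of_real (prob {\<omega> \<in> space M. inner_balls n K \<omega> = J \<and> inner_balls n (Suc K) \<omega> = {}})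
    = complex_of_real (prob {\<omega> \<in> space M. inner_balls n K \<omega> = J} * expectation (\<lambda>\<omega>. (1 - W \<omega>) ^ card J))"
    using transition(2)[of 1, OF _ assms, of K] unfolding empty_weight_1 ind[OF m(1)] ind[OF m(2)] by simp
  then show ?thesis by (simp only: of_real_eq_iff)
qed

text \<open>Both sides are the probability that the last ball is taken exactly in step
  \<open>Suc K\<close>. The right side telescopes in \<open>K\<close>, so these sums add up to at
  most 1.\<close>

lemma sum_prob_vanish:
  "(\<Sum>J\<in>Pow {1..n} - {{}}. prob {\<omega> \<in> space M. inner_balls n K \<omega> = J} * expectation (\<lambda>\<omega>. (1 - W \<omega>) ^ card J))
    = prob {\<omega> \<in> space M. inner_balls n (Suc K) \<omega> = {}} - prob {\<omega> \<in> space M. inner_balls n K \<omega> = {}}"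
proof -
  let ?E = "\<lambda>J. {\<omega> \<in> space M. inner_balls n K \<omega> = J \<and> inner_balls n (Suc K) \<omega> = {}}"
  let ?Z = "\<lambda>K. {\<omega> \<in> space M. inner_balls n K \<omega> = {}}"
  have "(\<Sum>J\<in>Pow {1..n} - {{}}. prob {\<omega> \<in> space M. inner_balls n K \<omega> = J} * expectation (\<lambda>\<omega>. (1 - W \<omega>) ^ card J))
      = (\<Sum>J\<in>Pow {1..n} - {{}}. prob (?E J))"
    by (intro sum.cong refl) (simp add: prob_vanish)
  also have "\<dots> = expectation (\<lambda>\<omega>. \<Sum>J\<in>Pow {1..n} - {{}}. indicator (?E J) \<omega>)"
    by (subst Bochner_Integration.integral_sum) (auto simp: emeasure_eq_measure)
  also have "\<dots> = expectation (\<lambda>\<omega>. indicator (?Z (Suc K)) \<omega> - indicator (?Z K) \<omega>)"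
  proof (rule integral_cong_AE)
    show "AE \<omega> in M. (\<Sum>J\<in>Pow {1..n} - {{}}. indicator (?E J) \<omega>)
        = (indicator (?Z (Suc K)) \<omega> - indicator (?Z K) \<omega> :: real)"
      using AE_regular AE_space
    proof eventually_elim
      case (elim \<omega>)
      let ?J = "inner_balls n K \<omega>"
      have "(\<Sum>J\<in>Pow {1..n} - {{}}. indicator (?E J) \<omega> :: real)
          = (\<Sum>J\<in>Pow {1..n} - {{}}. if J = ?J then indicator (?Z (Suc K)) \<omega> else 0)"
        using elim by (intro sum.cong) (auto simp: indicator_def)
      also have "\<dots> = (if ?J \<noteq> {} then indicator (?Z (Suc K)) \<omega> else 0)"
        using inner_balls_subset[of n K \<omega>] by (subst sum.delta) auto
      also have "\<dots> = indicator (?Z (Suc K)) \<omega> - indicator (?Z K) \<omega>"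
        using inner_balls_antimono[OF elim(1), of K "Suc K" n] elim(2) by (auto simp: indicator_def)
      finally show ?case .
    qed
  qed measurable
  also have "\<dots> = prob (?Z (Suc K)) - prob (?Z K)"
    by (subst Bochner_Integration.integral_diff) (auto simp: emeasure_eq_measure)
  finally show ?thesis .
qed

section \<open>One-step drift of the weighted value\<close>

text \<open>The candidate for the conditional expectation of \<open>s\<close> to the number of empty
  boxes still to come: the limiting value \<open>g\<close> while balls remain, and 1
  afterwards.\<close>

definition limit_value :: "complex \<Rightarrow> nat set \<Rightarrow> complex" where
  "limit_value g J = (if J = {} then 1 else g)"

text \<open>From state \<open>J\<close>, absorption changes the value by \<open>1 - g\<close> and an
  empty box by \<open>g * (s - 1)\<close>. The equation for \<open>g\<close> says
  \<open>1 - g = g * (1 - s) * c\<close>, so the two effects combine to \<open>g * (1 - s)\<close>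
  times the gap between \<open>c\<close> times the absorption probability and the probability of an
  empty box; \<open>norm (g * (1 - s)) \<le> 2\<close>.\<close>

lemma expectation_step:
  assumes s: "norm s \<le> 1" and g: "norm g \<le> 1" "g * (of_real c + 1 - of_real c * s) = 1"
  shows "norm (expectation (\<lambda>\<omega>. empty_weight s n (Suc K) \<omega> * limit_value g (inner_balls n (Suc K) \<omega>))
      - expectation (\<lambda>\<omega>. empty_weight s n K \<omega> * limit_value g (inner_balls n K \<omega>)))
    \<le> 2 * (\<Sum>J\<in>Pow {1..n} - {{}}. prob {\<omega> \<in> space M. inner_balls n K \<omega> = J}
        * \<bar>c * expectation (\<lambda>\<omega>. (1 - W \<omega>) ^ card J) - expectation (\<lambda>\<omega>. W \<omega> ^ card J)\<bar>)"
proof -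
  let ?S = "\<lambda>K \<omega>. inner_balls n K \<omega>" and ?Y = "\<lambda>K \<omega>. empty_weight s n K \<omega>"
  let ?V = "limit_value g"
  let ?C = "Pow {1..n} - {{}} :: nat set set"
  let ?v = "\<lambda>J \<omega>. if ?S K \<omega> = J then ?Y K \<omega> else 0"
  let ?stay = "\<lambda>J \<omega>. if ?S K \<omega> = J \<and> ?S (Suc K) \<omega> = J then ?Y K \<omega> else 0"
  let ?out = "\<lambda>J \<omega>. if ?S K \<omega> = J \<and> ?S (Suc K) \<omega> = {} then ?Y K \<omega> else 0"
  let ?a = "\<lambda>J :: nat set. expectation (\<lambda>\<omega>. W \<omega> ^ card J)"
  let ?b = "\<lambda>J :: nat set. expectation (\<lambda>\<omega>. (1 - W \<omega>) ^ card J)"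
  have int: "integrable M f" if "f \<in> borel_measurable M" "\<And>\<omega>. norm (f \<omega>) \<le> 1" for f :: "'a \<Rightarrow> complex"
    using that by (intro integrable_const_bound[of _ 1]) auto
  note Y1 = norm_empty_weight[OF s]
  have V1: "norm (?V J) \<le> 1" for J using g by (simp add: limit_value_def)
  have [measurable]: "(\<lambda>\<omega>. ?V (?S K \<omega>)) \<in> borel_measurable M" for K
    unfolding limit_value_def by measurable
  have int_F: "integrable M (\<lambda>\<omega>. ?Y K \<omega> * ?V (?S K \<omega>))" for K
    using Y1 V1 by (intro int) (auto simp: norm_mult intro!: mult_le_one)
  have int_so: "integrable M (?stay J)" "integrable M (?out J)" for J
    using Y1 by (intro int; auto)+
  have "expectation (\<lambda>\<omega>. ?Y (Suc K) \<omega> * ?V (?S (Suc K) \<omega>)) - expectation (\<lambda>\<omega>. ?Y K \<omega> * ?V (?S K \<omega>))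
      = expectation (\<lambda>\<omega>. ?Y (Suc K) \<omega> * ?V (?S (Suc K) \<omega>) - ?Y K \<omega> * ?V (?S K \<omega>))"
    by (rule Bochner_Integration.integral_diff[symmetric, OF int_F int_F])
  \<comment> \<open>A move to a proper nonempty subset changes neither weight nor value, and once no
    ball remains nothing changes any more.\<close>
  also have "\<dots> = expectation (\<lambda>\<omega>. \<Sum>J\<in>?C. (1 - g) * ?out J \<omega> - g * (1 - s) * ?stay J \<omega>)"
  proof (rule integral_cong_AE)
    show "AE \<omega> in M. ?Y (Suc K) \<omega> * ?V (?S (Suc K) \<omega>) - ?Y K \<omega> * ?V (?S K \<omega>)
        = (\<Sum>J\<in>?C. (1 - g) * ?out J \<omega> - g * (1 - s) * ?stay J \<omega>)"
      using AE_regular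
    proof eventually_elim
      case (elim \<omega>)
      have sub: "?S (Suc K) \<omega> \<subseteq> ?S K \<omega>" using inner_balls_antimono[OF elim] by auto
      have Y: "?Y (Suc K) \<omega> = ?Y K \<omega> * (if ?S (Suc K) \<omega> = ?S K \<omega> \<and> ?S (Suc K) \<omega> \<noteq> {} then s else 1)"
        by (simp add: empty_weight_def prod.nat_ivl_Suc')
      have "(\<Sum>J\<in>?C. (1 - g) * ?out J \<omega> - g * (1 - s) * ?stay J \<omega>)
          = (\<Sum>J\<in>?C. if J = ?S K \<omega> then (1 - g) * ?out J \<omega> - g * (1 - s) * ?stay J \<omega> else 0)"
        by (intro sum.cong) auto
      also have "\<dots> = (if ?S K \<omega> \<noteq> {} then (1 - g) * ?out (?S K \<omega>) \<omega> - g * (1 - s) * ?stay (?S K \<omega>) \<omega> else 0)"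
        using inner_balls_subset[of n K \<omega>] by (subst sum.delta) auto
      finally show ?case
        using sub unfolding Y by (auto simp: limit_value_def algebra_simps)
    qed
  qed measurable
  also have "\<dots> = (\<Sum>J\<in>?C. (1 - g) * expectation (?out J) - g * (1 - s) * expectation (?stay J))"
    using int_so by (subst Bochner_Integration.integral_sum) auto
  also have "\<dots> = (\<Sum>J\<in>?C. expectation (?v J) * (g * (1 - s) * complex_of_real (c * ?b J - ?a J)))"
  proof (intro sum.cong refl)
    fix J assume "J \<in> ?C"
    then have J: "J \<subseteq> {1..n}" "J \<noteq> {}" by auto
    have g1: "1 - g = g * (1 - s) * of_real c" using g(2) by (simp add: algebra_simps)
    show "(1 - g) * expectation (?out J) - g * (1 - s) * expectation (?stay J)
        = expectation (?v J) * (g * (1 - s) * complex_of_real (c * ?b J - ?a J))"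
      unfolding transition[OF s J] g1 by (simp add: algebra_simps)
  qed
  also have "norm \<dots> \<le> (\<Sum>J\<in>?C. prob {\<omega> \<in> space M. ?S K \<omega> = J} * (2 * \<bar>c * ?b J - ?a J\<bar>))"
  proof (rule sum_norm_le)
    fix J
    have "norm (expectation (?v J)) \<le> expectation (\<lambda>\<omega>. norm (?v J \<omega>))"
      by (rule integral_norm_bound)
    also have "\<dots> \<le> expectation (indicator {\<omega> \<in> space M. ?S K \<omega> = J})"
      using Y1 by (intro integral_mono integrable_norm int) (auto simp: emeasure_eq_measure indicator_def)
    finally have 1: "norm (expectation (?v J)) \<le> prob {\<omega> \<in> space M. ?S K \<omega> = J}" by simp
    have "norm (1 - s) \<le> 2" using norm_triangle_ineq4[of 1 s] s by simp
    then have "norm (g * (1 - s)) \<le> 1 * 2"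
      unfolding norm_mult using g by (intro mult_mono) auto
    then have 2: "norm (g * (1 - s) * complex_of_real (c * ?b J - ?a J)) \<le> 2 * \<bar>c * ?b J - ?a J\<bar>"
      by (simp only: norm_mult[of "g * (1 - s)"] norm_of_real) (intro mult_right_mono, auto)
    show "norm (expectation (?v J) * (g * (1 - s) * complex_of_real (c * ?b J - ?a J)))
        \<le> prob {\<omega> \<in> space M. ?S K \<omega> = J} * (2 * \<bar>c * ?b J - ?a J\<bar>)"
      unfolding norm_mult[of "expectation (?v J)"] by (intro mult_mono 1 2) auto
  qed
  also have "\<dots> = 2 * (\<Sum>J\<in>?C. prob {\<omega> \<in> space M. ?S K \<omega> = J} * \<bar>c * ?b J - ?a J\<bar>)"
    unfolding sum_distrib_left by (intro sum.cong refl) simp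
  finally show ?thesis .
qed

section \<open>Convergence of the number of empty boxes\<close>

lemma occupied_boxes_eq:
  assumes "regular \<omega>"
  shows "occupied_boxes Ws U n \<omega> = {k. 1 \<le> k \<and> inner_balls n k \<omega> \<noteq> inner_balls n (k - 1) \<omega>}"
proof -
  have "(\<exists>i\<in>{1..n}. U i \<omega> \<in> sieve_box Ws k \<omega>) \<longleftrightarrow> inner_balls n k \<omega> \<noteq> inner_balls n (k - 1) \<omega>" for k
  proof -
    have "inner_balls n k \<omega> \<noteq> inner_balls n (k - 1) \<omega> \<longleftrightarrow> (\<exists>i. i \<in> inner_balls n (k - 1) \<omega> \<and> i \<notin> inner_balls n k \<omega>)"
      using inner_balls_antimono[OF assms, of "k - 1" k n] by auto
    then show ?thesis by (auto simp: sieve_box_def inner_balls_def not_le)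
  qed
  then show ?thesis by (auto simp: occupied_boxes_def)
qed

text \<open>Up to the last occupied box \<open>m\<close>, each box is either in \<open>B\<close>
  (some ball leaves) or in \<open>E\<close> (no ball leaves although some remain), and beyond
  \<open>m\<close> nothing remains. Hence \<open>m = card B + card E\<close>, which also makes the
  natural-number subtraction exact.\<close>

lemma num_empty_eq:
  assumes reg: "regular \<omega>" and fin: "inner_balls n K \<omega> = {}"
  shows "num_empty Ws U n \<omega>
    = card {k\<in>{1..K}. inner_balls n k \<omega> = inner_balls n (k - 1) \<omega> \<and> inner_balls n k \<omega> \<noteq> {}}"
proof -
  let ?S = "\<lambda>k. inner_balls n k \<omega>"
  define B where "B = occupied_boxes Ws U n \<omega>"
  define E where "E = {k\<in>{1..K}. ?S k = ?S (k - 1) \<and> ?S k \<noteq> {}}"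
  define m where "m = last_occupied Ws U n \<omega>"
  have B: "B = {k. 1 \<le> k \<and> ?S k \<noteq> ?S (k - 1)}"
    unfolding B_def by (rule occupied_boxes_eq[OF reg])
  have k_le: "k \<le> K" if "k \<in> B" for k
  proof (rule ccontr)
    assume "\<not> k \<le> K"
    then have "?S k = {}" "?S (k - 1) = {}"
      using inner_balls_antimono[OF reg, of K k n] inner_balls_antimono[OF reg, of K "k - 1" n] fin by auto
    then show False using that by (simp add: B)
  qed
  have "1 \<le> k" if "k \<in> B" for k
    using that by (simp add: B)
  with k_le have "B \<subseteq> {1..K}" by auto
  then have "finite B" by (rule finite_subset) simp
  have m_le: "k \<le> m" if "k \<in> B" for k
    using that \<open>finite B\<close> by (auto simp: m_def last_occupied_def B_def[symmetric])
  have m_in: "m \<in> B" if "m \<noteq> 0"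
    using that \<open>finite B\<close> by (auto simp: m_def last_occupied_def B_def[symmetric] split: if_splits intro!: Max_in)
  \<comment> \<open>No box after \<open>m\<close> is occupied, so the state is constant from
    \<open>m\<close> on; at \<open>K\<close> it is empty, so it is empty from \<open>m\<close> on
    whenever \<open>m \<le> K\<close>.\<close>
  have const: "?S b = ?S a" if "m \<le> a" "a \<le> b" for a b
    using that(2)
  proof (induction rule: dec_induct)
    case (step j)
    then have "Suc j \<notin> B" using m_le[of "Suc j"] that(1) by auto
    then show ?case using step by (simp add: B)
  qed simp
  have "B \<union> E = {1..m}"
  proof (intro equalityI subsetI)
    fix k assume k: "k \<in> B \<union> E"
    moreover have "k \<le> m" if "k \<in> E"
    proof (rule ccontr)
      assume "\<not> k \<le> m"
      then have "?S K = ?S k" using that by (intro const) (auto simp: E_def)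
      then show False using that fin by (simp add: E_def)
    qed
    ultimately show "k \<in> {1..m}" using m_le by (auto simp: B E_def)
  next
    fix k assume k: "k \<in> {1..m}"
    then have "m \<in> B" by (intro m_in) auto
    then have m: "m \<le> K" "?S (m - 1) \<noteq> {}"
      using \<open>B \<subseteq> {1..K}\<close> inner_balls_antimono[OF reg, of "m - 1" m n] by (auto simp: B)
    show "k \<in> B \<union> E"
    proof (cases "k = m")
      case False
      then have "?S (m - 1) \<subseteq> ?S k" using k by (intro inner_balls_antimono[OF reg]) auto
      then show ?thesis using k m by (auto simp: B E_def)
    qed (use \<open>m \<in> B\<close> in simp)
  qed
  moreover have "B \<inter> E = {}" by (auto simp: B E_def)
  moreover have "finite E" by (simp add: E_def)
  ultimately have "m = card B + card E"
    using card_Un_disjoint[of B E] \<open>finite B\<close> by simp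
  then show ?thesis
    by (simp add: num_empty_def num_occupied_def B_def[symmetric] m_def[symmetric] E_def)
qed

lemma power_num_empty:
  assumes "regular \<omega>" "inner_balls n K \<omega> = {}"
  shows "s ^ num_empty Ws U n \<omega> = empty_weight s n K \<omega>"
  unfolding num_empty_eq[OF assms] empty_weight_def
  by (subst prod.inter_filter[symmetric]) auto

text \<open>The set of occupied boxes may be infinite on a null set. Replacing all infinite sets by
  \<open>UNIV\<close> leaves a map \<open>R\<close> into a countable collection. The number of empty
  boxes is a function of \<open>R\<close>, since \<open>card\<close> and \<open>Max\<close> take the
  same default values on all infinite sets.\<close>

lemma num_empty_measurable [measurable]: "num_empty Ws U n \<in> M \<rightarrow>\<^sub>M count_space UNIV"
proof -
  let ?occ = "occupied_boxes Ws U n"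
  have [measurable]: "random_variable borel (U i)" if "i \<in> {1..n}" for i
    using that by (intro U_measurable) auto
  have occ_eq: "Measurable.pred M (\<lambda>\<omega>. ?occ \<omega> = F)" for F
  proof -
    have "(\<lambda>\<omega>. ?occ \<omega> = F) = (\<lambda>\<omega>. \<forall>k. (1 \<le> k \<and> (\<exists>i\<in>{1..n}. sieve_T Ws k \<omega> < U i \<omega>
        \<and> U i \<omega> \<le> sieve_T Ws (k - 1) \<omega>)) = (k \<in> F))"
      by (auto simp: occupied_boxes_def sieve_box_def fun_eq_iff)
    also have "Measurable.pred M \<dots>" by measurable
    finally show ?thesis .
  qed
  let ?A = "insert UNIV {F :: nat set. finite F}"
  define R where "R \<omega> = (if finite (?occ \<omega>) then ?occ \<omega> else UNIV)" for \<omega>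
  have "countable ?A" by (simp add: countable_Collect_finite)
  have "R \<in> M \<rightarrow>\<^sub>M count_space ?A"
    unfolding measurable_count_space_eq_countable[OF \<open>countable ?A\<close>]
  proof (intro conjI ballI)
    have fin_meas: "{\<omega> \<in> space M. ?occ \<omega> = F} \<in> events" for F
      using occ_eq by measurable
    show "R -` {F} \<inter> space M \<in> events" if "F \<in> ?A" for F
    proof (cases "finite F")
      case True
      then have "R \<omega> = F \<longleftrightarrow> ?occ \<omega> = F" for \<omega>
        unfolding R_def by (cases "finite (?occ \<omega>)") auto
      then have "R -` {F} \<inter> space M = {\<omega> \<in> space M. ?occ \<omega> = F}" by blast
      then show ?thesis using fin_meas by simp
    next
      case False
      then have "R \<omega> = F \<longleftrightarrow> infinite (?occ \<omega>)" for \<omega>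
        unfolding R_def using that by (cases "finite (?occ \<omega>)") auto
      then have "R -` {F} \<inter> space M = space M - (\<Union>G\<in>{G. finite G}. {\<omega> \<in> space M. ?occ \<omega> = G})"
        by blast
      moreover have "(\<Union>G\<in>{G. finite G}. {\<omega> \<in> space M. ?occ \<omega> = G}) \<in> events"
        using fin_meas by (intro sets.countable_UN' countable_Collect_finite) auto
      ultimately show ?thesis by simp
    qed
  qed (auto simp: R_def)
  moreover define f where "f F = (if F = {} then 0 else Max F) - card F" for F :: "nat set"
  have "num_empty Ws U n \<omega> = f (R \<omega>)" for \<omega>
    by (auto simp: num_empty_def last_occupied_def num_occupied_def f_def R_def Max.infinite)
  then have "num_empty Ws U n = f \<circ> R" by (simp add: fun_eq_iff)
  ultimately show ?thesis by (auto intro: measurable_comp)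
qed

section \<open>Accumulated error and passage to the limit\<close>

lemma sum_prob_inner_balls_small:
  "(\<Sum>J\<in>Pow {1..n} - {{}}. prob {\<omega> \<in> space M. inner_balls n K \<omega> = J} * (if card J < N then 1 else 0))
    \<le> (\<Sum>m=1..<N. exp (real m) * fact (m + 1)) * (step ^^ K) bump (real n)"
proof -
  let ?C = "Pow {1..n} - {{}} :: nat set set"
  let ?p = "\<lambda>J. prob {\<omega> \<in> space M. inner_balls n K \<omega> = J}"
  have "(\<Sum>J\<in>?C. ?p J * (if card J < N then 1 else 0))
      = (\<Sum>J\<in>?C. \<Sum>m=1..<N. if card J = m then ?p J else 0)"
  proof (intro sum.cong refl)
    fix J assume "J \<in> ?C"
    then have "finite J" "J \<noteq> {}" by (auto intro: finite_subset)
    then have "1 \<le> card J" by (simp add: Suc_le_eq card_gt_0_iff)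
    then show "?p J * (if card J < N then 1 else 0) = (\<Sum>m=1..<N. if card J = m then ?p J else 0)"
      by simp
  qed
  also have "\<dots> = (\<Sum>m=1..<N. \<Sum>J\<in>?C. if card J = m then ?p J else 0)"
    by (rule sum.swap)
  also have "\<dots> = (\<Sum>m=1..<N. \<Sum>J | J \<subseteq> {1..n} \<and> card J = m. ?p J)"
  proof (rule sum.cong[OF refl])
    fix m assume m: "m \<in> {1..<N}"
    have "{J \<in> ?C. card J = m} = {J. J \<subseteq> {1..n} \<and> card J = m}" using m by auto
    then show "(\<Sum>J\<in>?C. if card J = m then ?p J else 0) = (\<Sum>J | J \<subseteq> {1..n} \<and> card J = m. ?p J)"
      by (subst sum.inter_filter[symmetric]) auto
  qed
  also have "\<dots> \<le> (\<Sum>m=1..<N. exp (real m) * fact (m + 1) * (step ^^ K) bump (real n))"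
    by (intro sum_mono sum_prob_inner_balls_le) auto
  finally show ?thesis by (simp add: sum_distrib_right)
qed

text \<open>For fixed \<open>n\<close>, every nonempty state has size below \<open>Suc n\<close>, so
  the bound on small states covers them all; it is a multiple of the terms of the convergent series
  for the bump potential.\<close>

lemma prob_inner_balls_nonempty_tendsto_0:
  "(\<lambda>K. prob {\<omega> \<in> space M. inner_balls n K \<omega> \<noteq> {}}) \<longlonglongrightarrow> 0"
proof (rule Lim_null_comparison)
  let ?D = "\<Sum>m=1..<Suc n. exp (real m) * fact (m + 1)"
  have "prob {\<omega> \<in> space M. inner_balls n K \<omega> \<noteq> {}} \<le> ?D * (step ^^ K) bump (real n)" for K
  proof -
    let ?C = "Pow {1..n} - {{}} :: nat set set"
    have "{\<omega> \<in> space M. inner_balls n K \<omega> \<noteq> {}} = (\<Union>J\<in>?C. {\<omega> \<in> space M. inner_balls n K \<omega> = J})"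
      using inner_balls_subset by auto
    also have "prob \<dots> \<le> (\<Sum>J\<in>?C. prob {\<omega> \<in> space M. inner_balls n K \<omega> = J})"
      by (intro finite_measure_subadditive_finite) auto
    also have "\<dots> = (\<Sum>J\<in>?C. prob {\<omega> \<in> space M. inner_balls n K \<omega> = J} * (if card J < Suc n then 1 else 0))"
    proof (intro sum.cong refl)
      fix J assume "J \<in> ?C"
      then have "card J \<le> n" using card_mono[of "{1..n}" J] by auto
      then show "prob {\<omega> \<in> space M. inner_balls n K \<omega> = J}
          = prob {\<omega> \<in> space M. inner_balls n K \<omega> = J} * (if card J < Suc n then 1 else 0)" by simp
    qed
    also have "\<dots> \<le> ?D * (step ^^ K) bump (real n)" by (rule sum_prob_inner_balls_small)
    finally show ?thesis .
  qed
  then show "eventually (\<lambda>K. norm (prob {\<omega> \<in> space M. inner_balls n K \<omega> \<noteq> {}}) \<le> ?D * (step ^^ K) bump (real n)) sequentially"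
    by simp
  have "(\<lambda>K. (step ^^ K) bump (real n)) \<longlonglongrightarrow> 0"
    by (rule summable_LIMSEQ_zero[OF bump_potential(1)]) simp
  then show "(\<lambda>K. ?D * (step ^^ K) bump (real n)) \<longlonglongrightarrow> 0"
    by (rule tendsto_mult_right_zero)
qed

text \<open>The one-step drifts are summed over \<open>K\<close>, from the initial value
  \<open>g\<close> to the limit, the expectation of \<open>s\<close> to the number of empty boxes.
  States of size at least \<open>N\<close> contribute \<open>e\<close> times the total absorption
  probability; smaller ones contribute a crude bound times their expected number of visits.\<close>

lemma norm_expectation_num_empty_diff_le:
  fixes s g :: complex
  assumes "1 \<le> n" and s: "norm s \<le> 1"
    and g: "norm g \<le> 1" "g * (of_real c + 1 - of_real c * s) = 1" and "0 < c" "0 \<le> e"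
    and close: "\<And>m. N \<le> m \<Longrightarrow> \<bar>c * expectation (\<lambda>\<omega>. (1 - W \<omega>) ^ m) - expectation (\<lambda>\<omega>. W \<omega> ^ m)\<bar>
      \<le> e * expectation (\<lambda>\<omega>. (1 - W \<omega>) ^ m)"
  shows "norm (expectation (\<lambda>\<omega>. s ^ num_empty Ws U n \<omega>) - g)
    \<le> 2 * (e + (c + 1) * (\<Sum>m=1..<N. exp (real m) * fact (m + 1)) * potential bump (real n))"
proof -
  let ?a = "\<lambda>m. expectation (\<lambda>\<omega>. W \<omega> ^ m)" and ?b = "\<lambda>m. expectation (\<lambda>\<omega>. (1 - W \<omega>) ^ m)"
  let ?C = "Pow {1..n} - {{}} :: nat set set"
  let ?p = "\<lambda>K J. prob {\<omega> \<in> space M. inner_balls n K \<omega> = J}"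
  let ?D = "(c + 1) * (\<Sum>m=1..<N. exp (real m) * fact (m + 1))"
  let ?F = "\<lambda>K. expectation (\<lambda>\<omega>. empty_weight s n K \<omega> * limit_value g (inner_balls n K \<omega>))"
  let ?L = "expectation (\<lambda>\<omega>. s ^ num_empty Ws U n \<omega>)"
  have "0 \<le> ?D" using \<open>0 < c\<close> by (auto intro!: mult_nonneg_nonneg sum_nonneg)
  have bound1: "0 \<le> ?a m" "?a m \<le> 1" "0 \<le> ?b m" "?b m \<le> 1" for m
  proof -
    have "0 \<le> W \<omega> ^ m" "W \<omega> ^ m \<le> 1" "0 \<le> (1 - W \<omega>) ^ m" "(1 - W \<omega>) ^ m \<le> 1" if "\<omega> \<in> space M" for \<omega>
      using factor_range[OF that] by (auto intro!: power_le_one)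
    then show "0 \<le> ?a m" "?a m \<le> 1" "0 \<le> ?b m" "?b m \<le> 1"
      by (auto intro!: integral_nonneg_AE integral_le_const integrable_const_bound[of _ 1])
  qed
  \<comment> \<open>For sizes below \<open>N\<close> nothing better is used than that both moments
    lie between 0 and 1.\<close>
  have gap: "\<bar>c * ?b m - ?a m\<bar> \<le> e * ?b m + (c + 1) * (if m < N then 1 else 0)" for m
  proof (cases "m < N")
    case True
    have "0 \<le> c * ?b m" "c * ?b m \<le> c" using bound1[of m] \<open>0 < c\<close> by (auto simp: mult_left_le)
    moreover have "0 \<le> e * ?b m" using bound1[of m] \<open>0 \<le> e\<close> by simp
    ultimately show ?thesis using True bound1[of m] by simp
  qed (use close[of m] in simp)
  have step: "norm (?F (Suc K) - ?F K)
      \<le> 2 * (e * (?p (Suc K) {} - ?p K {}) + ?D * (step ^^ K) bump (real n))" for K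
  proof -
    have "norm (?F (Suc K) - ?F K) \<le> 2 * (\<Sum>J\<in>?C. ?p K J * \<bar>c * ?b (card J) - ?a (card J)\<bar>)"
      by (rule expectation_step[OF s g])
    also have "\<dots> \<le> 2 * (\<Sum>J\<in>?C. ?p K J * (e * ?b (card J) + (c + 1) * (if card J < N then 1 else 0)))"
      by (intro mult_left_mono sum_mono gap) auto
    also have "(\<Sum>J\<in>?C. ?p K J * (e * ?b (card J) + (c + 1) * (if card J < N then 1 else 0)))
        = e * (\<Sum>J\<in>?C. ?p K J * ?b (card J)) + (c + 1) * (\<Sum>J\<in>?C. ?p K J * (if card J < N then 1 else 0))"
      unfolding sum_distrib_left sum.distrib[symmetric] by (intro sum.cong refl) (simp only: distrib_left mult.left_commute)
    also have "\<dots> \<le> e * (?p (Suc K) {} - ?p K {}) + ?D * (step ^^ K) bump (real n)"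
      using sum_prob_inner_balls_small[of n K N] \<open>0 < c\<close>
      unfolding sum_prob_vanish mult.assoc[of "c + 1"] by (intro add_left_mono mult_left_mono) auto
    finally show ?thesis by simp
  qed
  \<comment> \<open>With \<open>n \<ge> 1\<close> the chain starts in a nonempty state, where the
    value is \<open>g\<close> and no box has been counted.\<close>
  have F0: "?F 0 = g"
  proof -
    have "?F 0 = expectation (\<lambda>\<omega>. g)"
    proof (rule integral_cong_AE)
      show "AE \<omega> in M. empty_weight s n 0 \<omega> * limit_value g (inner_balls n 0 \<omega>) = g"
        using AE_regular
        by eventually_elim (use \<open>1 \<le> n\<close> in \<open>simp add: inner_balls_0 limit_value_def empty_weight_def\<close>)
      show "(\<lambda>\<omega>. empty_weight s n 0 \<omega> * limit_value g (inner_balls n 0 \<omega>)) \<in> borel_measurable M"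
        unfolding limit_value_def by measurable
    qed simp
    then show ?thesis by (simp add: prob_space)
  qed
  have sum: "norm (?F K - g) \<le> 2 * (e + ?D * potential bump (real n))" for K
  proof -
    have "norm (?F K - g) \<le> (\<Sum>k<K. 2 * (e * (?p (Suc k) {} - ?p k {}) + ?D * (step ^^ k) bump (real n)))"
    proof -
      have "?F K - g = (\<Sum>k<K. ?F (Suc k) - ?F k)"
        using sum_lessThan_telescope[of ?F K] F0 by simp
      then show ?thesis using sum_norm_le[of "{..<K}" "\<lambda>k. ?F (Suc k) - ?F k"] step by simp
    qed
    also have "\<dots> = 2 * (e * (\<Sum>k<K. ?p (Suc k) {} - ?p k {}) + ?D * (\<Sum>k<K. (step ^^ k) bump (real n)))"
      by (simp only: sum.distrib sum_distrib_left distrib_left)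
    also have "(\<Sum>k<K. ?p (Suc k) {} - ?p k {}) = ?p K {} - ?p 0 {}"
      by (rule sum_lessThan_telescope)
    also have "2 * (e * (?p K {} - ?p 0 {}) + ?D * (\<Sum>k<K. (step ^^ k) bump (real n)))
        \<le> 2 * (e * 1 + ?D * potential bump (real n))"
    proof (intro mult_left_mono add_mono \<open>0 \<le> e\<close> \<open>0 \<le> ?D\<close>)
      show "?p K {} - ?p 0 {} \<le> 1"
        by (smt (verit) measure_nonneg prob_le_1)
      show "(\<Sum>k<K. (step ^^ k) bump (real n)) \<le> potential bump (real n)"
        unfolding potential_def using step_pow_bounds[OF bump_measurable bump_bounds(1,2)]
        by (intro sum_le_suminf bump_potential(1)) auto
    qed auto
    finally show ?thesis by simp
  qed
  \<comment> \<open>Once all balls are placed the two integrands agree; before that, both are at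
    most 1 in norm.\<close>
  have tail: "norm (?L - ?F K) \<le> 2 * prob {\<omega> \<in> space M. inner_balls n K \<omega> \<noteq> {}}" for K
  proof -
    let ?V = "\<lambda>\<omega>. limit_value g (inner_balls n K \<omega>)"
    have [measurable]: "?V \<in> borel_measurable M" unfolding limit_value_def by measurable
    have s1: "norm (s ^ k) \<le> 1" for k using s by (simp add: norm_power power_le_one)
    have Y1: "norm (empty_weight s n K \<omega> * ?V \<omega>) \<le> 1" for \<omega>
      unfolding norm_mult using norm_empty_weight[OF s] g by (intro mult_le_one) (auto simp: limit_value_def)
    have int: "integrable M (\<lambda>\<omega>. s ^ num_empty Ws U n \<omega>)" "integrable M (\<lambda>\<omega>. empty_weight s n K \<omega> * ?V \<omega>)"
      using s1 Y1 by (intro integrable_const_bound[of _ 1]; auto)+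
    have diff: "?L - ?F K = expectation (\<lambda>\<omega>. s ^ num_empty Ws U n \<omega> - empty_weight s n K \<omega> * ?V \<omega>)"
      using int by simp
    have "norm (?L - ?F K) \<le> expectation (\<lambda>\<omega>. norm (s ^ num_empty Ws U n \<omega> - empty_weight s n K \<omega> * ?V \<omega>))"
      unfolding diff by (rule integral_norm_bound)
    also have "\<dots> \<le> expectation (\<lambda>\<omega>. 2 * indicator {\<omega> \<in> space M. inner_balls n K \<omega> \<noteq> {}} \<omega>)"
    proof (rule integral_mono_AE)
      show "AE \<omega> in M. norm (s ^ num_empty Ws U n \<omega> - empty_weight s n K \<omega> * ?V \<omega>)
          \<le> 2 * indicator {\<omega> \<in> space M. inner_balls n K \<omega> \<noteq> {}} \<omega>"
        using AE_regular AE_space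
      proof eventually_elim
        case (elim \<omega>)
        show ?case
        proof (cases "inner_balls n K \<omega> = {}")
          case True
          then have "s ^ num_empty Ws U n \<omega> - empty_weight s n K \<omega> * ?V \<omega> = 0"
            unfolding power_num_empty[OF elim(1) True] limit_value_def by simp
          then show ?thesis by (simp only: norm_zero) simp
        next
          case False
          have "norm (s ^ num_empty Ws U n \<omega> - empty_weight s n K \<omega> * ?V \<omega>) \<le> 1 + 1"
            by (intro order_trans[OF norm_triangle_ineq4] add_mono s1 Y1)
          moreover have "indicator {\<omega> \<in> space M. inner_balls n K \<omega> \<noteq> {}} \<omega> = (1 :: real)"
            using False elim(2) by simp
          ultimately show ?thesis by linarith
        qed
      qed
      show "integrable M (\<lambda>\<omega>. norm (s ^ num_empty Ws U n \<omega> - empty_weight s n K \<omega> * ?V \<omega>))"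
        by (intro integrable_norm Bochner_Integration.integrable_diff int)
    qed (auto simp: emeasure_eq_measure)
    also have "\<dots> = 2 * prob {\<omega> \<in> space M. inner_balls n K \<omega> \<noteq> {}}" by simp
    finally show ?thesis .
  qed
  show ?thesis
  \<comment> \<open>The left side does not depend on \<open>K\<close>, so the probability of
    remaining balls is removed by letting \<open>K\<close> tend to infinity.\<close>
  proof (rule LIMSEQ_le_const)
    show "(\<lambda>K. 2 * prob {\<omega> \<in> space M. inner_balls n K \<omega> \<noteq> {}} + 2 * (e + ?D * potential bump (real n)))
        \<longlonglongrightarrow> 2 * (e + ?D * potential bump (real n))"
      using tendsto_add[OF tendsto_mult_right_zero[OF prob_inner_balls_nonempty_tendsto_0] tendsto_const] by simp
    show "\<exists>K0. \<forall>K\<ge>K0. norm (?L - g)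
        \<le> 2 * prob {\<omega> \<in> space M. inner_balls n K \<omega> \<noteq> {}} + 2 * (e + ?D * potential bump (real n))"
    proof (intro exI allI impI)
      fix K
      have "norm (?L - g) \<le> norm (?L - ?F K) + norm (?F K - g)"
        using norm_triangle_ineq[of "?L - ?F K" "?F K - g"] by simp
      then show "norm (?L - g)
          \<le> 2 * prob {\<omega> \<in> space M. inner_balls n K \<omega> \<noteq> {}} + 2 * (e + ?D * potential bump (real n))"
        using tail[of K] sum[of K] by linarith
    qed
  qed
qed

text \<open>The parameters are chosen in order: first \<open>e\<close>, then \<open>N\<close> from
  the moment ratio, so that the gap is at most \<open>e\<close> times the absorption probability
  from size \<open>N\<close> on, and last a large \<open>n\<close>, for which the bump potential
  makes visits below \<open>N\<close> negligible.\<close>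

lemma expectation_power_num_empty_tendsto:
  fixes s :: complex
  assumes inf: "(\<integral>\<^sup>+\<omega>. ennreal \<bar>ln (W \<omega>)\<bar> \<partial>M) = \<infinity>" and "0 < c"
    and lim: "(\<lambda>n. expectation (\<lambda>\<omega>. W \<omega> ^ n) / expectation (\<lambda>\<omega>. (1 - W \<omega>) ^ n)) \<longlonglongrightarrow> c"
    and s: "norm s = 1"
  shows "(\<lambda>n. expectation (\<lambda>\<omega>. s ^ num_empty Ws U n \<omega>)) \<longlonglongrightarrow> 1 / (of_real c + 1 - of_real c * s)"
proof -
  let ?d = "of_real c + 1 - of_real c * s" and ?L = "\<lambda>n. expectation (\<lambda>\<omega>. s ^ num_empty Ws U n \<omega>)"
  define g where "g = 1 / ?d"
  \<comment> \<open>The denominator stays at distance at least \<open>(c + 1) - c = 1\<close> from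
    0, so \<open>g\<close> is well defined and has norm at most 1.\<close>
  have "norm (complex_of_real (c + 1)) - norm (of_real c * s) \<le> norm ?d"
    using norm_triangle_ineq2[of "complex_of_real (c + 1)" "of_real c * s"] by simp
  then have d: "1 \<le> norm ?d" using \<open>0 < c\<close> s unfolding norm_mult norm_of_real by simp
  then have "?d \<noteq> 0" by auto
  then have g: "norm g \<le> 1" "g * ?d = 1"
    using d unfolding g_def norm_divide by (auto simp: divide_le_eq_1)
  let ?a = "\<lambda>m. expectation (\<lambda>\<omega>. W \<omega> ^ m)" and ?b = "\<lambda>m. expectation (\<lambda>\<omega>. (1 - W \<omega>) ^ m)"
  have b: "0 < ?b m" for m
    using factor_range
    by (intro expectation_greater integrable_moment AE_I2) auto
  have "(\<lambda>n. potential bump (real n)) \<longlonglongrightarrow> 0"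
    by (rule filterlim_compose[OF potential_bump_tendsto_0[OF inf] filterlim_real_sequentially])
  show ?thesis
  proof (rule metric_LIMSEQ_I)
    fix r :: real assume "0 < r"
    \<comment> \<open>The contribution \<open>2 * e = r / 2\<close> leaves room below
      \<open>r\<close> for the vanishing term.\<close>
    define e where "e = r / 4"
    have "0 < e" using \<open>0 < r\<close> by (simp add: e_def)
    obtain N where N: "\<And>m. N \<le> m \<Longrightarrow> dist (?a m / ?b m) c < e"
      using metric_LIMSEQ_D[OF lim \<open>0 < e\<close>] by blast
    have close: "\<bar>c * ?b m - ?a m\<bar> \<le> e * ?b m" if "N \<le> m" for m
    proof -
      have "c * ?b m - ?a m = (c - ?a m / ?b m) * ?b m" using b[of m] by (simp add: field_simps)
      then have "\<bar>c * ?b m - ?a m\<bar> = \<bar>c - ?a m / ?b m\<bar> * ?b m" using b[of m] by (simp add: abs_mult)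
      also have "\<dots> \<le> e * ?b m"
        using N[OF that] b[of m] by (intro mult_right_mono) (auto simp: dist_real_def abs_minus_commute)
      finally show ?thesis .
    qed
    let ?D = "(c + 1) * (\<Sum>m=1..<N. exp (real m) * fact (m + 1))"
    have "(\<lambda>n. 2 * (e + ?D * potential bump (real n))) \<longlonglongrightarrow> 2 * (e + ?D * 0)"
      by (intro tendsto_intros) fact
    moreover have "2 * (e + ?D * 0) < r" using \<open>0 < r\<close> by (simp add: e_def)
    ultimately have "eventually (\<lambda>n. 2 * (e + ?D * potential bump (real n)) < r) sequentially"
      by (rule order_tendstoD)
    then have "eventually (\<lambda>n. dist (?L n) g < r) sequentially"
      using eventually_ge_at_top[of 1]
    proof eventually_elim
      case (elim n)
      have "norm (?L n - g) \<le> 2 * (e + ?D * potential bump (real n))"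
        using s \<open>0 < e\<close> by (intro norm_expectation_num_empty_diff_le[OF elim(2) _ g \<open>0 < c\<close> _ close]) auto
      then show ?case using elim(1) unfolding dist_norm by linarith
    qed
    then show "\<exists>n0. \<forall>n\<ge>n0. dist (?L n) (1 / ?d) < r"
      by (simp add: eventually_sequentially g_def)
  qed
qed

text \<open>The characteristic function at \<open>t\<close> is the generating function at the point
  \<open>iexp t\<close> of the unit circle, so Levy continuity reduces the claim to the previous
  limit and a geometric series.\<close>

lemma num_empty_weak_conv:
  assumes inf: "(\<integral>\<^sup>+\<omega>. ennreal \<bar>ln (W \<omega>)\<bar> \<partial>M) = \<infinity>" and "0 < c"
    and lim: "(\<lambda>n. expectation (\<lambda>\<omega>. W \<omega> ^ n) / expectation (\<lambda>\<omega>. (1 - W \<omega>) ^ n)) \<longlonglongrightarrow> c"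
  shows "weak_conv_m (\<lambda>n. distr M borel (\<lambda>\<omega>. real (num_empty Ws U n \<omega>)))
    (distr (measure_pmf (geometric_pmf (1 / (c + 1)))) borel real)"
proof (rule levy_continuity)
  let ?p = "1 / (c + 1)"
  let ?G = "measure_pmf (geometric_pmf ?p)"
  show "real_distribution (distr M borel (\<lambda>\<omega>. real (num_empty Ws U n \<omega>)))" for n
    by (rule real_distribution_distr) measurable
  show "real_distribution (distr ?G borel real)"
    by (rule prob_space.real_distribution_distr[OF prob_space_measure_pmf]) simp
  fix t
  let ?s = "iexp t"
  have s: "norm ?s = 1" by simp
  have iexp: "iexp (t * real k) = ?s ^ k" for k
    by (simp add: exp_of_nat_mult[symmetric] mult_ac)
  have "char (distr M borel (\<lambda>\<omega>. real (num_empty Ws U n \<omega>))) t = expectation (\<lambda>\<omega>. ?s ^ num_empty Ws U n \<omega>)" for n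
  proof -
    have "char (distr M borel (\<lambda>\<omega>. real (num_empty Ws U n \<omega>))) t = expectation (\<lambda>\<omega>. iexp (t * real (num_empty Ws U n \<omega>)))"
      unfolding char_def by (rule integral_distr) measurable
    then show ?thesis by (simp only: iexp)
  qed
  moreover have "char (distr ?G borel real) t = 1 / (of_real c + 1 - of_real c * ?s)"
  proof -
    have p: "0 < ?p" "?p \<le> 1" "1 - ?p = c / (c + 1)" using \<open>0 < c\<close> by (auto simp: field_simps)
    let ?q = "complex_of_real (c / (c + 1)) * ?s"
    have "norm ?q < 1" unfolding norm_mult s norm_of_real using \<open>0 < c\<close> by simp
    let ?f = "\<lambda>k. pmf (geometric_pmf ?p) k *\<^sub>R ?s ^ k"
    have f: "?f k = complex_of_real ?p * ?q ^ k" for k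
    proof -
      have "pmf (geometric_pmf ?p) k = (c / (c + 1)) ^ k * ?p"
        unfolding p(3)[symmetric] using p by (intro pmf_geometric)
      then show ?thesis
        by (simp only: scaleR_conv_of_real of_real_mult of_real_power power_mult_distrib mult_ac)
    qed
    have "?f sums (complex_of_real ?p * (1 / (1 - ?q)))"
      unfolding f using \<open>norm ?q < 1\<close> by (intro sums_mult geometric_sums)
    moreover have "summable (\<lambda>k. norm (?f k))"
      unfolding f norm_mult[of "complex_of_real ?p"] norm_power using \<open>norm ?q < 1\<close>
      by (intro summable_mult summable_geometric) simp
    ultimately have int: "integrable (count_space UNIV) ?f" "(\<Sum>k. ?f k) = complex_of_real ?p * (1 / (1 - ?q))"
      by (simp_all add: integrable_count_space_nat_iff sums_iff)
    have "char (distr ?G borel real) t = (\<integral>k. iexp (t * real k) \<partial>?G)"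
      unfolding char_def by (rule integral_distr) measurable
    also have "\<dots> = (\<integral>k. ?s ^ k \<partial>?G)"
      by (simp only: iexp)
    also have "\<dots> = (\<integral>k. ?f k \<partial>count_space UNIV)"
      unfolding measure_pmf_eq_density by (subst integral_density) auto
    also have "\<dots> = complex_of_real ?p * (1 / (1 - ?q))"
      using integral_count_space_nat[OF int(1)] int(2) by simp
    also have "\<dots> = 1 / (of_real c + 1 - of_real c * ?s)"
    proof -
      have "complex_of_real (c + 1) \<noteq> 0" using \<open>0 < c\<close> by (simp only: of_real_eq_0_iff)
      then show ?thesis by (simp add: field_simps)
    qed
    finally show ?thesis .
  qed
  ultimately show "(\<lambda>n. char (distr M borel (\<lambda>\<omega>. real (num_empty Ws U n \<omega>))) t) \<longlonglongrightarrow> char (distr ?G borel real) t"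
    using expectation_power_num_empty_tendsto[OF inf \<open>0 < c\<close> lim s] by simp
qed

end

theorem theorem1p1:
  fixes M :: "'a measure" and W :: "'a \<Rightarrow> real" and Ws U :: "nat \<Rightarrow> 'a \<Rightarrow> real" and c :: real
  assumes sieve: "bernoulli_sieve M W Ws U"
    and mu_infinite: "(\<integral>\<^sup>+\<omega>. ennreal \<bar>ln (W \<omega>)\<bar> \<partial>M) = \<infinity>"
    and c_pos: "0 < c"
  shows "((\<lambda>n. (\<integral>\<omega>. W \<omega> ^ n \<partial>M) / (\<integral>\<omega>. (1 - W \<omega>) ^ n \<partial>M)) \<longlonglongrightarrow> c
          \<longrightarrow> weak_conv_m (\<lambda>n. distr M borel (\<lambda>\<omega>. real (num_empty Ws U n \<omega>)))
                (distr (measure_pmf (geometric_pmf (1 / (c + 1)))) borel real))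
       \<and> (((\<lambda>x. measure M {\<omega> \<in> space M. 1 - W \<omega> \<le> x} / measure M {\<omega> \<in> space M. W \<omega> \<le> x})
            \<longlongrightarrow> c) (at_right 0)
          \<longrightarrow> weak_conv_m (\<lambda>n. distr M borel (\<lambda>\<omega>. real (num_empty Ws U n \<omega>)))
                (distr (measure_pmf (geometric_pmf (1 / (c + 1)))) borel real))"
proof -
  interpret bernoulli_sieve M W Ws U by (rule sieve)
  \<comment> \<open>With \<open>X = 1 - W\<close> and \<open>Y = W\<close>, the moments of
    \<open>1 - X\<close> and \<open>1 - Y\<close> are those of \<open>W\<close> and
    \<open>1 - W\<close>, so the tail condition implies the moment condition.\<close>
  have "(\<lambda>n. expectation (\<lambda>\<omega>. W \<omega> ^ n) / expectation (\<lambda>\<omega>. (1 - W \<omega>) ^ n)) \<longlonglongrightarrow> c"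
    if "((\<lambda>x. prob {\<omega> \<in> space M. 1 - W \<omega> \<le> x} / prob {\<omega> \<in> space M. W \<omega> \<le> x}) \<longlongrightarrow> c) (at_right 0)"
    using moment_ratio_tendsto[of "\<lambda>\<omega>. 1 - W \<omega>" W c] that factor_range c_pos by simp
  then show ?thesis
    using num_empty_weak_conv[OF mu_infinite c_pos] by blast
qed

end
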